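(* Let $(G,\mu,\alpha,\beta)$ be a BiHom-algebra over a field $\mathbb K$ of characteristic $0$ with $\beta$ surjective, and let $(M,\rho,\kappa,\tau)$ be a right BiHom-module over $G$. Let $G^{\circ}\subseteq G^{*}$ and $M^{\circ}\subseteq M^{*}$ be the Sweedler duals, and set $\rho^{\circ}:=\rho^{*}|_{M^{\circ}}$, $\kappa^{\circ}:=\kappa^{*}|_{M^{\circ}}$, $\tau^{\circ}:=\tau^{*}|_{M^{\circ}}$, where $\rho^{*}:M^{*}\to(M\otimes G)^{*}$, $\rho^{*}(\xi)=\xi\circ\rho$, is the linear dual of $\rho$, and $\kappa^{*}(\xi)=\xi\circ\kappa$, $\tau^{*}(\xi)=\xi\circ\tau$. Then $\rho^{\circ}$ takes values in $M^{\circ}\otimes G^{\circ}$ (viewed inside $(M\otimes G)^{*}$), and $(M^{\circ},\rho^{\circ},\tau^{\circ},\kappa^{\circ})$ is a right BiHom-comodule over the Sweedler dual BiHom-coalgebra $(G^{\circ},\Delta,\beta^{\circ},\alpha^{\circ})$.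
   Context: All vector spaces and tensor products are over a field $\mathbb K$ of characteristic $0$; spaces may be infinite-dimensional. $V^{*}$ denotes the full linear dual. $U^{*}\otimes V^{*}$ is viewed as a subspace of $(U\otimes V)^{*}$ via $(f\otimes g)(x\otimes y)=f(x)g(y)$. A BiHom-algebra is a quadruple $(G,\mu,\alpha,\beta)$ with $G$ a vector space, $\mu:G\otimes G\to G$ linear, written $\mu(g\otimes h)=gh$, and $\alpha,\beta:G\to G$ linear with $\alpha\circ\beta=\beta\circ\alpha$, such that for all $g,h,k\in G$: $\alpha(g)(hk)=(gh)\beta(k)$, $\alpha(hk)=\alpha(h)\alpha(k)$, $\beta(hk)=\beta(h)\beta(k)$. No unit is assumed. An ideal of $G$ is a subspace $H\subseteq G$ with $\alpha(H)\subseteq H$, $\beta(H)\subseteq H$, and $ab\in H$, $ba\in H$ for all $a\in G$, $b\in H$. It is finite-codimensional if $\dim(G/H)<\infty$. A right BiHom-module over $G$ is a quadruple $(M,\rho,\kappa,\tau)$ with $M$ a vector space, $\rho:M\otimes G\to M$ linear, written $\rho(m\otimes g)=m\cdot g$, and commuting linear maps $\kappa,\tau:M\to M$ such that $\rho\circ(\rho\otimes\beta)=\rho\circ(\kappa\otimes\mu)$, $\rho\circ(\kappa\otimes\alpha)=\kappa\circ\rho$, $\rho\circ(\tau\otimes\beta)=\tau\circ\rho$. For an ideal $J\subseteq G$, $M\cdot J$ denotes the linear span of all $m\cdot j$ with $m\in M$, $j\in J$. Sweedler duals: $G^{\circ}=\{f\in G^{*}\mid f(J)=0 \text{ for some finite-codimensional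 ideal } J\subseteq G\}$ and $M^{\circ}=\{f\in M^{*}\mid f(M\cdot J)=0 \text{ for some finite-codimensional ideal } J\subseteq G\}$. A BiHom-coalgebra is a quadruple $(C,\Delta,\psi,\phi)$ with $C$ a vector space, $\Delta:C\to C\otimes C$ linear, $\psi,\phi:C\to C$ commuting linear maps, such that $(\phi\otimes\Delta)\circ\Delta=(\Delta\otimes\psi)\circ\Delta$, $\Delta\circ\psi=(\psi\otimes\psi)\circ\Delta$, $\Delta\circ\phi=(\phi\otimes\phi)\circ\Delta$. The Sweedler dual BiHom-coalgebra of $G$ is $(G^{\circ},\Delta,\beta^{\circ},\alpha^{\circ})$ (so $\psi=\beta^{\circ}$, $\phi=\alpha^{\circ}$) with $\Delta(f)=f\circ\mu\in G^{\circ}\otimes G^{\circ}\subseteq(G\otimes G)^{*}$, $\alpha^{\circ}(f)=f\circ\alpha$, $\beta^{\circ}(f)=f\circ\beta$; it is a known fact that this is a BiHom-coalgebra. A right BiHom-comodule over a BiHom-coalgebra $(C,\Delta,\psi,\phi)$ is a quadruple $(A,\gamma,\omega,\theta)$ with $A$ a vector space, $\gamma:A\to A\otimes C$ linear, and commuting linear maps $\omega,\theta:A\to A$ such that $(\gamma\otimes\psi)\circ\gamma=(\theta\otimes\Delta)\circ\gamma$, $(\omega\otimes\psi)\circ\gamma=\gamma\circ\omega$, $(\theta\otimes\phi)\circ\gamma=\gamma\circ\theta$. *)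

theory Defs
  imports Complex_Main "HOL-Library.Function_Algebras"
begin

section \<open>Vector spaces with carriers, and their tensor products\<close>

text \<open>
  The Sweedler duals are proper subspaces of a dual space that depend on the given structure maps,
  so a vector space is a subspace of a type together with a scalar multiplication of that type.
\<close>

record ('k, 'a) vsp =
  vcar :: "'a set"
  vscale :: "'k \<Rightarrow> 'a \<Rightarrow> 'a"

definition vspace :: "('k::field, 'a::ab_group_add) vsp \<Rightarrow> bool" where
  "vspace V \<longleftrightarrow> vector_space (vscale V) \<and> module.subspace (vscale V) (vcar V)"

definition ground :: "('k::field, 'k) vsp" where
  "ground = \<lparr>vcar = UNIV, vscale = (*)\<rparr>"

definition pointwise :: "'k::field \<Rightarrow> ('i \<Rightarrow> 'k) \<Rightarrow> ('i \<Rightarrow> 'k)" where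
  "pointwise c f = (\<lambda>i. c * f i)"

definition lin_map ::
  "('k::field, 'a::ab_group_add) vsp \<Rightarrow> ('k, 'b::ab_group_add) vsp \<Rightarrow> ('a \<Rightarrow> 'b) \<Rightarrow> bool" where
  "lin_map V W f \<longleftrightarrow>
     (\<forall>x\<in>vcar V. f x \<in> vcar W) \<and>
     (\<forall>x\<in>vcar V. \<forall>y\<in>vcar V. f (x + y) = f x + f y) \<and>
     (\<forall>c. \<forall>x\<in>vcar V. f (vscale V c x) = vscale W c (f x))"

definition bilin_map ::
  "('k::field, 'a::ab_group_add) vsp \<Rightarrow> ('k, 'b::ab_group_add) vsp \<Rightarrow> ('k, 'c::ab_group_add) vsp
     \<Rightarrow> ('a \<Rightarrow> 'b \<Rightarrow> 'c) \<Rightarrow> bool" where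
  "bilin_map V W X F \<longleftrightarrow>
     (\<forall>y\<in>vcar W. lin_map V X (\<lambda>x. F x y)) \<and> (\<forall>x\<in>vcar V. lin_map W X (F x))"

text \<open>
  The tensor product is realised as the span of the evaluation functionals \<open>b \<mapsto> b x y\<close>
  on the space of bilinear forms \<open>b\<close> on \<open>V \<times> W\<close>.  Lemma \<open>tensor_universal\<close> below is its
  universal property.
\<close>

type_synonym ('k, 'a, 'b) tensor = "('a \<Rightarrow> 'b \<Rightarrow> 'k) \<Rightarrow> 'k"

definition pure ::
  "('k::field, 'a::ab_group_add) vsp \<Rightarrow> ('k, 'b::ab_group_add) vsp \<Rightarrow> 'a \<Rightarrow> 'b
     \<Rightarrow> ('k, 'a, 'b) tensor" where
  "pure V W x y = (\<lambda>b. if bilin_map V W ground b then b x y else 0)"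

definition tensor ::
  "('k::field, 'a::ab_group_add) vsp \<Rightarrow> ('k, 'b::ab_group_add) vsp
     \<Rightarrow> ('k, ('k, 'a, 'b) tensor) vsp" (infixr "\<otimes>" 70) where
  "V \<otimes> W =
     \<lparr>vcar = module.span pointwise {pure V W x y | x y. x \<in> vcar V \<and> y \<in> vcar W},
      vscale = pointwise\<rparr>"

text \<open>
  The linear map on the tensor product induced by a bilinear map.  Like all maps that are
  elements of a space below, it is normalised to be 0 outside its domain.
\<close>

definition lift ::
  "('k::field, 'a::ab_group_add) vsp \<Rightarrow> ('k, 'b::ab_group_add) vsp \<Rightarrow> ('k, 'c::ab_group_add) vsp
     \<Rightarrow> ('a \<Rightarrow> 'b \<Rightarrow> 'c) \<Rightarrow> ('k, 'a, 'b) tensor \<Rightarrow> 'c" where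
  "lift V W X F =
     (THE h. lin_map (V \<otimes> W) X h \<and> (\<forall>t. t \<notin> vcar (V \<otimes> W) \<longrightarrow> h t = 0) \<and>
        (\<forall>x\<in>vcar V. \<forall>y\<in>vcar W. h (pure V W x y) = F x y))"

text \<open>\<open>tmap V W V' W' f g\<close> is \<open>f \<otimes> g\<close> from \<open>V \<otimes> W\<close> to \<open>V' \<otimes> W'\<close>.\<close>

definition tmap ::
  "('k::field, 'a::ab_group_add) vsp \<Rightarrow> ('k, 'b::ab_group_add) vsp
     \<Rightarrow> ('k, 'c::ab_group_add) vsp \<Rightarrow> ('k, 'd::ab_group_add) vsp
     \<Rightarrow> ('a \<Rightarrow> 'c) \<Rightarrow> ('b \<Rightarrow> 'd) \<Rightarrow> ('k, 'a, 'b) tensor \<Rightarrow> ('k, 'c, 'd) tensor" where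
  "tmap V W V' W' f g = lift V W (V' \<otimes> W') (\<lambda>x y. pure V' W' (f x) (g y))"

text \<open>The canonical isomorphism from \<open>(U \<otimes> V) \<otimes> W\<close> to \<open>U \<otimes> (V \<otimes> W)\<close>.\<close>

definition tassoc ::
  "('k::field, 'a::ab_group_add) vsp \<Rightarrow> ('k, 'b::ab_group_add) vsp \<Rightarrow> ('k, 'c::ab_group_add) vsp
     \<Rightarrow> ('k, ('k, 'a, 'b) tensor, 'c) tensor \<Rightarrow> ('k, 'a, ('k, 'b, 'c) tensor) tensor" where
  "tassoc U V W =
     lift (U \<otimes> V) W (U \<otimes> (V \<otimes> W))
       (\<lambda>s z. lift U V (U \<otimes> (V \<otimes> W)) (\<lambda>x y. pure U (V \<otimes> W) x (pure V W y z)) s)"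

definition dual :: "('k::field, 'a::ab_group_add) vsp \<Rightarrow> ('k, 'a \<Rightarrow> 'k) vsp" where
  "dual V =
     \<lparr>vcar = {f. lin_map V ground f \<and> (\<forall>x. x \<notin> vcar V \<longrightarrow> f x = 0)}, vscale = pointwise\<rparr>"

text \<open>\<open>dual_map V h\<close> is \<open>h\<^sup>*\<close> for a linear map \<open>h\<close> with domain \<open>V\<close>.\<close>

definition dual_map ::
  "('k::field, 'a::ab_group_add) vsp \<Rightarrow> ('a \<Rightarrow> 'b) \<Rightarrow> ('b \<Rightarrow> 'k) \<Rightarrow> ('a \<Rightarrow> 'k)" where
  "dual_map V h \<xi> = (\<lambda>x. if x \<in> vcar V then \<xi> (h x) else 0)"

text \<open>
  For subspaces \<open>E\<close> of \<open>V\<^sup>*\<close> and \<open>F\<close> of \<open>W\<^sup>*\<close>, the inclusion of \<open>E \<otimes> F\<close> into \<open>(V \<otimes> W)\<^sup>*\<close>;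
  see lemmas \<open>dual_incl_pure\<close> and \<open>inj_on_dual_incl\<close> below.
\<close>

definition dual_incl ::
  "('k::field, 'a::ab_group_add) vsp \<Rightarrow> ('k, 'b::ab_group_add) vsp
     \<Rightarrow> ('k, 'a \<Rightarrow> 'k) vsp \<Rightarrow> ('k, 'b \<Rightarrow> 'k) vsp
     \<Rightarrow> ('k, 'a \<Rightarrow> 'k, 'b \<Rightarrow> 'k) tensor \<Rightarrow> (('k, 'a, 'b) tensor \<Rightarrow> 'k)" where
  "dual_incl V W E F = lift E F (dual (V \<otimes> W)) (\<lambda>f g. lift V W ground (\<lambda>x y. f x * g y))"


section \<open>BiHom-algebras, modules, coalgebras and comodules\<close>

locale bihom_algebra =
  fixes G :: "('k::field, 'g::ab_group_add) vsp"
    and \<mu> :: "('k, 'g, 'g) tensor \<Rightarrow> 'g"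
    and \<alpha> \<beta> :: "'g \<Rightarrow> 'g"
  assumes G_vspace: "vspace G"
    and mu_lin: "lin_map (G \<otimes> G) G \<mu>"
    and alpha_lin: "lin_map G G \<alpha>"
    and beta_lin: "lin_map G G \<beta>"
    and alpha_beta: "\<And>g. g \<in> vcar G \<Longrightarrow> \<alpha> (\<beta> g) = \<beta> (\<alpha> g)"
    and bihom_assoc: "\<And>g h k. g \<in> vcar G \<Longrightarrow> h \<in> vcar G \<Longrightarrow> k \<in> vcar G \<Longrightarrow>
      \<mu> (pure G G (\<alpha> g) (\<mu> (pure G G h k))) = \<mu> (pure G G (\<mu> (pure G G g h)) (\<beta> k))"
    and alpha_mult: "\<And>h k. h \<in> vcar G \<Longrightarrow> k \<in> vcar G \<Longrightarrow>
      \<alpha> (\<mu> (pure G G h k)) = \<mu> (pure G G (\<alpha> h) (\<alpha> k))"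
    and beta_mult: "\<And>h k. h \<in> vcar G \<Longrightarrow> k \<in> vcar G \<Longrightarrow>
      \<beta> (\<mu> (pure G G h k)) = \<mu> (pure G G (\<beta> h) (\<beta> k))"

locale bihom_right_module = bihom_algebra G \<mu> \<alpha> \<beta>
  for G :: "('k::field, 'g::ab_group_add) vsp" and \<mu> \<alpha> \<beta> +
  fixes M :: "('k, 'm::ab_group_add) vsp"
    and \<rho> :: "('k, 'm, 'g) tensor \<Rightarrow> 'm"
    and \<kappa> \<tau> :: "'m \<Rightarrow> 'm"
  assumes M_vspace: "vspace M"
    and rho_lin: "lin_map (M \<otimes> G) M \<rho>"
    and kappa_lin: "lin_map M M \<kappa>"
    and tau_lin: "lin_map M M \<tau>"
    and kappa_tau: "\<And>m. m \<in> vcar M \<Longrightarrow> \<kappa> (\<tau> m) = \<tau> (\<kappa> m)"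
    and module_assoc: "\<And>t. t \<in> vcar ((M \<otimes> G) \<otimes> G) \<Longrightarrow>
      \<rho> (tmap (M \<otimes> G) G M G \<rho> \<beta> t) = \<rho> (tmap M (G \<otimes> G) M G \<kappa> \<mu> (tassoc M G G t))"
    and kappa_rho: "\<And>t. t \<in> vcar (M \<otimes> G) \<Longrightarrow> \<rho> (tmap M G M G \<kappa> \<alpha> t) = \<kappa> (\<rho> t)"
    and tau_rho: "\<And>t. t \<in> vcar (M \<otimes> G) \<Longrightarrow> \<rho> (tmap M G M G \<tau> \<beta> t) = \<tau> (\<rho> t)"

locale bihom_coalgebra =
  fixes C :: "('k::field, 'c::ab_group_add) vsp"
    and \<Delta> :: "'c \<Rightarrow> ('k, 'c, 'c) tensor"
    and \<psi> \<phi> :: "'c \<Rightarrow> 'c"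
  assumes C_vspace: "vspace C"
    and Delta_lin: "lin_map C (C \<otimes> C) \<Delta>"
    and psi_lin: "lin_map C C \<psi>"
    and phi_lin: "lin_map C C \<phi>"
    and psi_phi: "\<And>c. c \<in> vcar C \<Longrightarrow> \<psi> (\<phi> c) = \<phi> (\<psi> c)"
    and bihom_coassoc: "\<And>c. c \<in> vcar C \<Longrightarrow>
      tmap C C C (C \<otimes> C) \<phi> \<Delta> (\<Delta> c) = tassoc C C C (tmap C C (C \<otimes> C) C \<Delta> \<psi> (\<Delta> c))"
    and psi_comult: "\<And>c. c \<in> vcar C \<Longrightarrow> \<Delta> (\<psi> c) = tmap C C C C \<psi> \<psi> (\<Delta> c)"
    and phi_comult: "\<And>c. c \<in> vcar C \<Longrightarrow> \<Delta> (\<phi> c) = tmap C C C C \<phi> \<phi> (\<Delta> c)"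

locale bihom_right_comodule = bihom_coalgebra C \<Delta> \<psi> \<phi>
  for C :: "('k::field, 'c::ab_group_add) vsp" and \<Delta> \<psi> \<phi> +
  fixes A :: "('k, 'a::ab_group_add) vsp"
    and \<gamma> :: "'a \<Rightarrow> ('k, 'a, 'c) tensor"
    and \<omega> \<theta> :: "'a \<Rightarrow> 'a"
  assumes A_vspace: "vspace A"
    and gamma_lin: "lin_map A (A \<otimes> C) \<gamma>"
    and omega_lin: "lin_map A A \<omega>"
    and theta_lin: "lin_map A A \<theta>"
    and omega_theta: "\<And>a. a \<in> vcar A \<Longrightarrow> \<omega> (\<theta> a) = \<theta> (\<omega> a)"
    and comodule_coassoc: "\<And>a. a \<in> vcar A \<Longrightarrow>
      tassoc A C C (tmap A C (A \<otimes> C) C \<gamma> \<psi> (\<gamma> a)) = tmap A C A (C \<otimes> C) \<theta> \<Delta> (\<gamma> a)"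
    and omega_gamma: "\<And>a. a \<in> vcar A \<Longrightarrow> tmap A C A C \<omega> \<psi> (\<gamma> a) = \<gamma> (\<omega> a)"
    and theta_gamma: "\<And>a. a \<in> vcar A \<Longrightarrow> tmap A C A C \<theta> \<phi> (\<gamma> a) = \<gamma> (\<theta> a)"


section \<open>Sweedler duals\<close>

definition bihom_ideal ::
  "('k::field, 'g::ab_group_add) vsp \<Rightarrow> (('k, 'g, 'g) tensor \<Rightarrow> 'g) \<Rightarrow> ('g \<Rightarrow> 'g) \<Rightarrow> ('g \<Rightarrow> 'g)
     \<Rightarrow> 'g set \<Rightarrow> bool" where
  "bihom_ideal G \<mu> \<alpha> \<beta> H \<longleftrightarrow>
     H \<subseteq> vcar G \<and> module.subspace (vscale G) H \<and> \<alpha> ` H \<subseteq> H \<and> \<beta> ` H \<subseteq> H \<and>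
     (\<forall>a\<in>vcar G. \<forall>b\<in>H. \<mu> (pure G G a b) \<in> H \<and> \<mu> (pure G G b a) \<in> H)"

text \<open>\<open>dim (V/H) < \<infinity>\<close>: the cosets of finitely many vectors span \<open>V/H\<close>.\<close>

definition finite_codim :: "('k::field, 'a::ab_group_add) vsp \<Rightarrow> 'a set \<Rightarrow> bool" where
  "finite_codim V H \<longleftrightarrow>
     (\<exists>B. finite B \<and> B \<subseteq> vcar V \<and> (\<forall>x\<in>vcar V. \<exists>b\<in>module.span (vscale V) B. x - b \<in> H))"

definition module_times_ideal ::
  "('k::field, 'g::ab_group_add) vsp \<Rightarrow> ('k, 'm::ab_group_add) vsp \<Rightarrow> (('k, 'm, 'g) tensor \<Rightarrow> 'm)
     \<Rightarrow> 'g set \<Rightarrow> 'm set" where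
  "module_times_ideal G M \<rho> J =
     module.span (vscale M) {\<rho> (pure M G m j) | m j. m \<in> vcar M \<and> j \<in> J}"

definition sweedler_algebra ::
  "('k::field, 'g::ab_group_add) vsp \<Rightarrow> (('k, 'g, 'g) tensor \<Rightarrow> 'g) \<Rightarrow> ('g \<Rightarrow> 'g) \<Rightarrow> ('g \<Rightarrow> 'g)
     \<Rightarrow> ('k, 'g \<Rightarrow> 'k) vsp" where
  "sweedler_algebra G \<mu> \<alpha> \<beta> =
     (dual G)\<lparr>vcar := {f \<in> vcar (dual G).
        \<exists>J. bihom_ideal G \<mu> \<alpha> \<beta> J \<and> finite_codim G J \<and> (\<forall>x\<in>J. f x = 0)}\<rparr>"

definition sweedler_module ::
  "('k::field, 'g::ab_group_add) vsp \<Rightarrow> (('k, 'g, 'g) tensor \<Rightarrow> 'g) \<Rightarrow> ('g \<Rightarrow> 'g) \<Rightarrow> ('g \<Rightarrow> 'g)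
     \<Rightarrow> ('k, 'm::ab_group_add) vsp \<Rightarrow> (('k, 'm, 'g) tensor \<Rightarrow> 'm) \<Rightarrow> ('k, 'm \<Rightarrow> 'k) vsp" where
  "sweedler_module G \<mu> \<alpha> \<beta> M \<rho> =
     (dual M)\<lparr>vcar := {f \<in> vcar (dual M).
        \<exists>J. bihom_ideal G \<mu> \<alpha> \<beta> J \<and> finite_codim G J \<and> (\<forall>x\<in>module_times_ideal G M \<rho> J. f x = 0)}\<rparr>"

text \<open>
  For the next two definitions: \<open>\<mu>\<^sup>*\<close> and \<open>\<rho>\<^sup>*\<close> take values in \<open>(G \<otimes> G)\<^sup>*\<close> and \<open>(M \<otimes> G)\<^sup>*\<close>,
  and the inverse of the inclusion turns values in the image of \<open>G\<degree> \<otimes> G\<degree>\<close> and \<open>M\<degree> \<otimes> G\<degree>\<close>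
  into elements of these tensor products.
\<close>

definition sweedler_comult ::
  "('k::field, 'g::ab_group_add) vsp \<Rightarrow> (('k, 'g, 'g) tensor \<Rightarrow> 'g) \<Rightarrow> ('g \<Rightarrow> 'g) \<Rightarrow> ('g \<Rightarrow> 'g)
     \<Rightarrow> ('g \<Rightarrow> 'k) \<Rightarrow> ('k, 'g \<Rightarrow> 'k, 'g \<Rightarrow> 'k) tensor" where
  "sweedler_comult G \<mu> \<alpha> \<beta> f =
     (let G' = sweedler_algebra G \<mu> \<alpha> \<beta>
      in the_inv_into (vcar (G' \<otimes> G')) (dual_incl G G G' G') (dual_map (G \<otimes> G) \<mu> f))"

definition sweedler_coaction ::
  "('k::field, 'g::ab_group_add) vsp \<Rightarrow> (('k, 'g, 'g) tensor \<Rightarrow> 'g) \<Rightarrow> ('g \<Rightarrow> 'g) \<Rightarrow> ('g \<Rightarrow> 'g)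
     \<Rightarrow> ('k, 'm::ab_group_add) vsp \<Rightarrow> (('k, 'm, 'g) tensor \<Rightarrow> 'm)
     \<Rightarrow> ('m \<Rightarrow> 'k) \<Rightarrow> ('k, 'm \<Rightarrow> 'k, 'g \<Rightarrow> 'k) tensor" where
  "sweedler_coaction G \<mu> \<alpha> \<beta> M \<rho> \<xi> =
     (let G' = sweedler_algebra G \<mu> \<alpha> \<beta>; M' = sweedler_module G \<mu> \<alpha> \<beta> M \<rho>
      in the_inv_into (vcar (M' \<otimes> G')) (dual_incl M G M' G') (dual_map (M \<otimes> G) \<rho> \<xi>))"


section \<open>The universal property of the tensor product\<close>

lemma vector_space_pointwise: "vector_space (pointwise :: 'k::field \<Rightarrow> ('i \<Rightarrow> 'k) \<Rightarrow> _)"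
  by standard (auto simp: pointwise_def fun_eq_iff algebra_simps)

interpretation pw: vector_space "pointwise :: 'k::field \<Rightarrow> ('i \<Rightarrow> 'k) \<Rightarrow> _"
  by (rule vector_space_pointwise)

lemma vspace_tensor: "vspace (V \<otimes> W)"
  by (simp add: vspace_def tensor_def vector_space_pointwise)

lemma vector_space_mult: "vector_space ((*) :: 'k::field \<Rightarrow> _)"
  by standard (auto simp: algebra_simps)

lemma vspace_ground: "vspace ground"
proof -
  interpret v: vector_space "(*) :: 'k::field \<Rightarrow> _" by (rule vector_space_mult)
  have "v.subspace UNIV" by (rule v.subspace_UNIV)
  then show ?thesis by (simp add: vspace_def ground_def vector_space_mult)
qed

lemma vspace_closed:
  assumes "vspace V"
  shows "0 \<in> vcar V" "x \<in> vcar V \<Longrightarrow> y \<in> vcar V \<Longrightarrow> x + y \<in> vcar V"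
    "x \<in> vcar V \<Longrightarrow> vscale V c x \<in> vcar V" "vscale V c 0 = 0" "vscale V 0 z = 0"
    "vscale V c (x + y) = vscale V c x + vscale V c y" "vscale V 1 x = x"
    "vscale V c (vscale V d x) = vscale V (c * d) x"
proof -
  interpret vector_space "vscale V" using assms by (simp add: vspace_def)
  have *: "subspace (vcar V)" using assms by (simp add: vspace_def)
  show "0 \<in> vcar V" "x \<in> vcar V \<Longrightarrow> y \<in> vcar V \<Longrightarrow> x + y \<in> vcar V"
    "x \<in> vcar V \<Longrightarrow> vscale V c x \<in> vcar V"
    using * by (auto simp: subspace_def)
  show "vscale V c 0 = 0" "vscale V 0 z = 0"
    "vscale V c (x + y) = vscale V c x + vscale V c y" "vscale V 1 x = x"
    "vscale V c (vscale V d x) = vscale V (c * d) x"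
    by (simp_all add: scale_right_distrib)
qed

lemma lin_map_zero: "vspace V \<Longrightarrow> lin_map V W f \<Longrightarrow> f 0 = 0"
  using vspace_closed(1)[of V] unfolding lin_map_def
  by (metis add_cancel_right_right)

lemma lin_map_add:
  assumes "vspace X" "lin_map W X f" "lin_map W X g"
  shows "lin_map W X (\<lambda>z. f z + g z)"
  unfolding lin_map_def
proof (intro conjI ballI allI)
  fix x c assume x: "x \<in> vcar W"
  show "f x + g x \<in> vcar X" "f (vscale W c x) + g (vscale W c x) = vscale X c (f x + g x)"
    using x assms by (simp_all add: lin_map_def vspace_closed(2,6))
  fix y assume y: "y \<in> vcar W"
  have "f (x + y) = f x + f y" "g (x + y) = g x + g y"
    using x y assms by (simp_all add: lin_map_def)
  then show "f (x + y) + g (x + y) = f x + g x + (f y + g y)" by (simp only: ac_simps)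
qed

lemma lin_map_cong:
  assumes "vspace W" "lin_map W X f" "\<And>z. z \<in> vcar W \<Longrightarrow> f z = g z"
  shows "lin_map W X g"
  using assms(2) vspace_closed(2,3)[OF assms(1)] assms(3) by (simp add: lin_map_def)

lemma separating_form:
  assumes "vspace X" "w \<noteq> 0"
  obtains \<phi> where "lin_map X ground \<phi>" "\<phi> w \<noteq> 0"
proof -
  interpret p: vector_space_pair "vscale X" "(*)"
    using assms(1) by (simp add: vector_space_pair_def vector_space_mult vspace_def)
  have ind: "p.vs1.independent {w}" using assms(2) by simp
  let ?f = "p.construct {w} (\<lambda>_. 1)"
  have l: "Vector_Spaces.linear (vscale X) (*) ?f" by (rule p.linear_construct[OF ind])
  show thesis
  proof
    show "lin_map X ground ?f"
      using p.linear_add[OF l] p.linear_scale[OF l] by (auto simp: lin_map_def ground_def)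
    show "?f w \<noteq> 0" using p.construct_basis[OF ind] by simp
  qed
qed

lemma pure_in_tensor: "x \<in> vcar V \<Longrightarrow> y \<in> vcar W \<Longrightarrow> pure V W x y \<in> vcar (V \<otimes> W)"
  by (auto simp: tensor_def intro!: pw.span_base)

lemma bilin_pure:
  assumes "vspace V" "vspace W"
  shows "bilin_map V W (V \<otimes> W) (pure V W)"
  unfolding bilin_map_def lin_map_def
  by (auto simp: pure_in_tensor)
    (auto simp: pure_def fun_eq_iff tensor_def pointwise_def bilin_map_def lin_map_def ground_def)

lemma tensor_induct [consumes 3, case_names pure add]:
  assumes V: "vspace V" "vspace W" and t: "t \<in> vcar (V \<otimes> W)"
    and p: "\<And>x y. x \<in> vcar V \<Longrightarrow> y \<in> vcar W \<Longrightarrow> P (pure V W x y)"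
    and a: "\<And>s t. s \<in> vcar (V \<otimes> W) \<Longrightarrow> t \<in> vcar (V \<otimes> W) \<Longrightarrow> P s \<Longrightarrow> P t \<Longrightarrow> P (s + t)"
  shows "P t"
proof -
  note cl = vspace_closed[OF vspace_tensor[of V W]]
  have b: "pure V W (vscale V c x) y = pointwise c (pure V W x y)"
    if "x \<in> vcar V" "y \<in> vcar W" for c x y
    using bilin_pure[OF V] that by (auto simp: bilin_map_def lin_map_def tensor_def)
  have "pure V W 0 0 = 0"
    using b[of 0 0 0] vspace_closed[OF V(1)] vspace_closed(1)[OF V(2)] by simp
  then have z: "P 0" using p[of 0 0] V by (simp add: vspace_closed)
  have "t \<in> vcar (V \<otimes> W) \<and> P t"
    using t unfolding tensor_def vsp.simps
  proof (induction rule: pw.span_induct_alt)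
    case base
    from pw.span_zero z show ?case by (rule conjI)
  next
    case (step c s t)
    then obtain x y where s: "s = pure V W x y" "x \<in> vcar V" "y \<in> vcar W" by auto
    have "P (pointwise c s)" "pointwise c s \<in> vcar (V \<otimes> W)"
      using p[of "vscale V c x" y] pure_in_tensor[of "vscale V c x" V y W] s b V
      by (auto simp: vspace_closed)
    then have "pointwise c s + t \<in> vcar (V \<otimes> W) \<and> P (pointwise c s + t)"
      using a[of "pointwise c s" t] step cl(2)[of "pointwise c s" t] by (auto simp: tensor_def)
    then show ?case unfolding tensor_def vsp.simps .
  qed
  then show ?thesis by simp
qed

lemma tensor_map_unique:
  assumes "vspace V" "vspace W" "lin_map (V \<otimes> W) X h" "lin_map (V \<otimes> W) X h'"
    and "\<And>x y. x \<in> vcar V \<Longrightarrow> y \<in> vcar W \<Longrightarrow> h (pure V W x y) = h' (pure V W x y)"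
    and "t \<in> vcar (V \<otimes> W)"
  shows "h t = h' t"
  using assms(1,2,6)
proof (induction rule: tensor_induct)
  case (pure x y)
  then show ?case by (rule assms(5))
next
  case (add s t)
  then have "h (s + t) = h' (s + t)" using assms(3,4) by (simp add: lin_map_def)
  then show ?case .
qed

lemma tensor_map_exists:
  assumes V: "vspace V" "vspace W" and X: "vspace X" and F: "bilin_map V W X F"
  shows "\<exists>h. lin_map (V \<otimes> W) X h \<and> (\<forall>t. t \<notin> vcar (V \<otimes> W) \<longrightarrow> h t = 0) \<and>
    (\<forall>x\<in>vcar V. \<forall>y\<in>vcar W. h (pure V W x y) = F x y)"
proof -
  define R where "R t w \<longleftrightarrow> t \<in> vcar (V \<otimes> W) \<and> w \<in> vcar X \<and>
    (\<forall>\<phi>. lin_map X ground \<phi> \<longrightarrow> \<phi> w = t (\<lambda>x y. \<phi> (F x y)))" for t w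
  note cl = vspace_closed[OF vspace_tensor[of V W]] and clX = vspace_closed[OF X]
  interpret x: vector_space "vscale X" using X by (simp add: vspace_def)
  have sX: "x.subspace (vcar X)" using X by (simp add: vspace_def)
  have uniq: "w = w'" if "R t w" "R t w'" for t w w'
  proof (rule ccontr)
    assume "w \<noteq> w'"
    then obtain \<phi> where \<phi>: "lin_map X ground \<phi>" "\<phi> (w - w') \<noteq> 0"
      using separating_form[OF X, of "w - w'"] by auto
    have "w - w' \<in> vcar X" using that x.subspace_diff[OF sX] by (auto simp: R_def)
    then have "\<phi> w = \<phi> (w - w') + \<phi> w'"
      using \<phi>(1) that by (metis R_def diff_add_cancel lin_map_def)
    moreover have "\<phi> w = t (\<lambda>x y. \<phi> (F x y))" "\<phi> w' = t (\<lambda>x y. \<phi> (F x y))"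
      using \<phi>(1) that unfolding R_def by blast+
    ultimately show False using \<phi>(2) by simp
  qed
  have Rp: "R (pure V W x y) (F x y)" if "x \<in> vcar V" "y \<in> vcar W" for x y
  proof -
    have "bilin_map V W ground (\<lambda>x y. \<phi> (F x y))" if "lin_map X ground \<phi>" for \<phi>
      using F that by (auto simp: bilin_map_def lin_map_def)
    then show ?thesis using that F
      by (auto simp: R_def pure_in_tensor) (auto simp: pure_def bilin_map_def lin_map_def)
  qed
  have Ra: "R (s + t) (v + w)" if "R s v" "R t w" for s t v w
    using that cl(2) clX(2) by (auto simp: R_def lin_map_def)
  have Rs: "R (pointwise c t) (vscale X c w)" if "R t w" for c t w
    using that cl(3)[of t c] clX(3)
    by (auto simp: R_def lin_map_def tensor_def pointwise_def ground_def)
  have ex: "\<exists>w. R t w" if "t \<in> vcar (V \<otimes> W)" for t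
    using V that
  proof (induction rule: tensor_induct)
    case (pure x y) then show ?case using Rp by blast
  next
    case (add s t) then show ?case using Ra by blast
  qed
  define h where "h t = (if t \<in> vcar (V \<otimes> W) then THE w. R t w else 0)" for t
  have h: "h t = w" if "R t w" for t w
    using that uniq by (auto simp: h_def R_def[of t w])
  have hR: "R t (h t)" if "t \<in> vcar (V \<otimes> W)" for t
    using ex[OF that] h by auto
  have "lin_map (V \<otimes> W) X h"
    unfolding lin_map_def
  proof (intro conjI ballI allI)
    fix s assume s: "s \<in> vcar (V \<otimes> W)"
    show "h s \<in> vcar X" using hR[OF s] by (simp add: R_def)
    show "h (vscale (V \<otimes> W) c s) = vscale X c (h s)" for c
      using h[OF Rs[OF hR[OF s]]] by (simp add: tensor_def)
    show "h (s + t) = h s + h t" if "t \<in> vcar (V \<otimes> W)" for t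
      using h[OF Ra[OF hR[OF s] hR[OF that]]] .
  qed
  moreover have "h (pure V W x y) = F x y" if "x \<in> vcar V" "y \<in> vcar W" for x y
    using h[OF Rp[OF that]] .
  ultimately show ?thesis by (intro exI[of _ h]) (auto simp: h_def)
qed

theorem tensor_universal:
  assumes "vspace V" "vspace W" "vspace X" "bilin_map V W X F"
  shows "\<exists>!h. lin_map (V \<otimes> W) X h \<and> (\<forall>t. t \<notin> vcar (V \<otimes> W) \<longrightarrow> h t = 0) \<and>
    (\<forall>x\<in>vcar V. \<forall>y\<in>vcar W. h (pure V W x y) = F x y)"
proof (rule ex_ex1I[OF tensor_map_exists[OF assms]])
  fix h h'
  assume h: "lin_map (V \<otimes> W) X h \<and> (\<forall>t. t \<notin> vcar (V \<otimes> W) \<longrightarrow> h t = 0) \<and>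
      (\<forall>x\<in>vcar V. \<forall>y\<in>vcar W. h (pure V W x y) = F x y)"
    and h': "lin_map (V \<otimes> W) X h' \<and> (\<forall>t. t \<notin> vcar (V \<otimes> W) \<longrightarrow> h' t = 0) \<and>
      (\<forall>x\<in>vcar V. \<forall>y\<in>vcar W. h' (pure V W x y) = F x y)"
  show "h = h'"
  proof
    fix t
    show "h t = h' t"
      using h h' tensor_map_unique[OF assms(1,2), of X h h' t] by (cases "t \<in> vcar (V \<otimes> W)") auto
  qed
qed

lemma lift_properties:
  assumes "vspace V" "vspace W" "vspace X" "bilin_map V W X F"
  shows "lin_map (V \<otimes> W) X (lift V W X F)"
    and "t \<notin> vcar (V \<otimes> W) \<Longrightarrow> lift V W X F t = 0"
    and "x \<in> vcar V \<Longrightarrow> y \<in> vcar W \<Longrightarrow> lift V W X F (pure V W x y) = F x y"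
  using theI'[OF tensor_universal[OF assms]] by (auto simp: lift_def)

lemma tmap_properties:
  assumes "vspace V" "vspace W" "vspace V'" "vspace W'" "lin_map V V' f" "lin_map W W' g"
  shows "lin_map (V \<otimes> W) (V' \<otimes> W') (tmap V W V' W' f g)"
    and "x \<in> vcar V \<Longrightarrow> y \<in> vcar W \<Longrightarrow>
      tmap V W V' W' f g (pure V W x y) = pure V' W' (f x) (g y)"
proof -
  have "bilin_map V W (V' \<otimes> W') (\<lambda>x y. pure V' W' (f x) (g y))"
    using bilin_pure[OF assms(3,4)] assms(5,6) by (auto simp: bilin_map_def lin_map_def)
  note * = lift_properties[OF assms(1,2) vspace_tensor this]
  show "lin_map (V \<otimes> W) (V' \<otimes> W') (tmap V W V' W' f g)"
    using * by (simp add: tmap_def)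
  show "tmap V W V' W' f g (pure V W x y) = pure V' W' (f x) (g y)"
    if "x \<in> vcar V" "y \<in> vcar W"
    using * that by (simp add: tmap_def)
qed

lemma tassoc_properties:
  assumes U: "vspace U" and V: "vspace V" and W: "vspace W"
  shows "lin_map ((U \<otimes> V) \<otimes> W) (U \<otimes> (V \<otimes> W)) (tassoc U V W)"
    and "x \<in> vcar U \<Longrightarrow> y \<in> vcar V \<Longrightarrow> z \<in> vcar W \<Longrightarrow>
      tassoc U V W (pure (U \<otimes> V) W (pure U V x y) z) = pure U (V \<otimes> W) x (pure V W y z)"
proof -
  let ?X = "U \<otimes> (V \<otimes> W)"
  let ?F = "\<lambda>z x y. pure U (V \<otimes> W) x (pure V W y z)"
  let ?L = "\<lambda>s z. lift U V ?X (?F z) s"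
  note VW = vspace_tensor[of V W] and X = vspace_tensor[of U "V \<otimes> W"]
  have F: "bilin_map U V ?X (?F z)" if "z \<in> vcar W" for z
    using bilin_pure[OF V W] bilin_pure[OF U VW] that
    by (auto simp: bilin_map_def lin_map_def pure_in_tensor)
  have Fz: "lin_map W ?X (\<lambda>z. ?F z x y)" if "x \<in> vcar U" "y \<in> vcar V" for x y
    using bilin_pure[OF V W] bilin_pure[OF U VW] that
    by (auto simp: bilin_map_def lin_map_def pure_in_tensor)
  note L = lift_properties[OF U V X F]
  have Lz: "lin_map W ?X (?L s)" if "s \<in> vcar (U \<otimes> V)" for s
    using U V that
  proof (induction rule: tensor_induct)
    case (pure x y)
    then show ?case using Fz[OF pure] W by (simp add: lin_map_def L(3) vspace_closed)
  next
    case (add s t)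
    have *: "?L (s + t) z = ?L s z + ?L t z" if "z \<in> vcar W" for z
      using L(1)[OF that] add by (simp add: lin_map_def)
    show ?case
      by (rule lin_map_cong[OF W lin_map_add[OF X add(3,4)]]) (rule *[symmetric])
  qed
  have b: "bilin_map (U \<otimes> V) W ?X ?L"
    using Lz L(1) by (simp add: bilin_map_def)
  note * = lift_properties[OF vspace_tensor W X b]
  show "lin_map ((U \<otimes> V) \<otimes> W) (U \<otimes> (V \<otimes> W)) (tassoc U V W)"
    using * by (simp add: tassoc_def)
  show "tassoc U V W (pure (U \<otimes> V) W (pure U V x y) z) = pure U (V \<otimes> W) x (pure V W y z)"
    if "x \<in> vcar U" "y \<in> vcar V" "z \<in> vcar W"
    using * that L(3) by (simp add: tassoc_def pure_in_tensor)
qed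


section \<open>The inclusion of a tensor product of dual spaces\<close>

lemma vspace_dual:
  assumes V: "vspace V"
  shows "vspace (dual V)"
proof -
  note c = vspace_closed[OF V]
  have "pw.subspace {f. lin_map V ground f \<and> (\<forall>x. x \<notin> vcar V \<longrightarrow> f x = 0)}"
  proof (rule pw.subspaceI)
    show "0 \<in> {f. lin_map V ground f \<and> (\<forall>x. x \<notin> vcar V \<longrightarrow> f x = 0)}"
      by (simp add: lin_map_def ground_def)
  next
    fix f g assume "f \<in> {f. lin_map V ground f \<and> (\<forall>x. x \<notin> vcar V \<longrightarrow> f x = 0)}"
      "g \<in> {f. lin_map V ground f \<and> (\<forall>x. x \<notin> vcar V \<longrightarrow> f x = 0)}"
    then show "f + g \<in> {f. lin_map V ground f \<and> (\<forall>x. x \<notin> vcar V \<longrightarrow> f x = 0)}"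
      using lin_map_add[OF vspace_ground, of V f g] by (simp add: plus_fun_def)
  next
    fix f c assume "f \<in> {f. lin_map V ground f \<and> (\<forall>x. x \<notin> vcar V \<longrightarrow> f x = 0)}"
    then show "pointwise c f \<in> {f. lin_map V ground f \<and> (\<forall>x. x \<notin> vcar V \<longrightarrow> f x = 0)}"
      by (simp add: lin_map_def ground_def pointwise_def distrib_left mult.left_commute)
  qed
  then show ?thesis by (simp add: vspace_def dual_def vector_space_pointwise)
qed

locale dual_pair =
  fixes V :: "('k::field, 'a::ab_group_add) vsp" and W :: "('k, 'b::ab_group_add) vsp"
    and E :: "('k, 'a \<Rightarrow> 'k) vsp" and F :: "('k, 'b \<Rightarrow> 'k) vsp"
  assumes V: "vspace V" and W: "vspace W" and E: "vspace E" and F: "vspace F"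
    and sE: "vcar E \<subseteq> vcar (dual V)" "vscale E = pointwise"
    and sF: "vcar F \<subseteq> vcar (dual W)" "vscale F = pointwise"
begin

abbreviation "B f g \<equiv> lift V W ground (\<lambda>x y. f x * g y)"

lemma bilin_prod: "f \<in> vcar E \<Longrightarrow> g \<in> vcar F \<Longrightarrow> bilin_map V W ground (\<lambda>x y. f x * g y)"
  using subsetD[OF sE(1), of f] subsetD[OF sF(1), of g]
  by (simp add: bilin_map_def lin_map_def ground_def dual_def distrib_left distrib_right
      mult.assoc mult.left_commute)

lemmas B_properties = lift_properties[OF V W vspace_ground bilin_prod]

lemma B_dual: "f \<in> vcar E \<Longrightarrow> g \<in> vcar F \<Longrightarrow> B f g \<in> vcar (dual (V \<otimes> W))"
  using B_properties(1,2) by (auto simp: dual_def)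

lemma form_eqI:
  assumes "p \<in> vcar (dual (V \<otimes> W))" "q \<in> vcar (dual (V \<otimes> W))"
    and "\<And>x y. x \<in> vcar V \<Longrightarrow> y \<in> vcar W \<Longrightarrow> p (pure V W x y) = q (pure V W x y)"
  shows "p = q"
proof
  fix t
  show "p t = q t"
    using assms tensor_map_unique[OF V W, of ground p q t]
    by (cases "t \<in> vcar (V \<otimes> W)") (auto simp: dual_def)
qed

lemma bilin_B: "bilin_map E F (dual (V \<otimes> W)) B"
proof -
  note d = vspace_closed(2,3)[OF vspace_dual[OF vspace_tensor[of V W]]]
  note cE = vspace_closed(2,3)[OF E] and cF = vspace_closed(2,3)[OF F]
  have ds: "vscale (dual (V \<otimes> W)) = pointwise" by (simp add: dual_def)
  note P = B_properties(3)
  have 1: "B (f + f') g = B f g + B f' g"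
    if f: "f \<in> vcar E" "f' \<in> vcar E" "g \<in> vcar F" for f f' g
  proof (rule form_eqI)
    show "B (f + f') g \<in> vcar (dual (V \<otimes> W))" by (rule B_dual[OF cE(1) f(3)]) fact+
    show "B f g + B f' g \<in> vcar (dual (V \<otimes> W))" by (intro d B_dual f)
    fix x y assume xy: "x \<in> vcar V" "y \<in> vcar W"
    show "B (f + f') g (pure V W x y) = (B f g + B f' g) (pure V W x y)"
      using P[OF cE(1)[OF f(1,2)] f(3) xy] P[OF f(1,3) xy] P[OF f(2,3) xy]
      by (simp only: plus_fun_apply distrib_right)
  qed
  have 2: "B f (g + g') = B f g + B f g'"
    if f: "f \<in> vcar E" "g \<in> vcar F" "g' \<in> vcar F" for f g g'
  proof (rule form_eqI)
    show "B f (g + g') \<in> vcar (dual (V \<otimes> W))" by (rule B_dual[OF f(1) cF(1)]) fact+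
    show "B f g + B f g' \<in> vcar (dual (V \<otimes> W))" by (intro d B_dual f)
    fix x y assume xy: "x \<in> vcar V" "y \<in> vcar W"
    show "B f (g + g') (pure V W x y) = (B f g + B f g') (pure V W x y)"
      using P[OF f(1) cF(1)[OF f(2,3)] xy] P[OF f(1,2) xy] P[OF f(1,3) xy]
      by (simp only: plus_fun_apply distrib_left)
  qed
  have 3: "B (vscale E c f) g = vscale (dual (V \<otimes> W)) c (B f g)"
    if f: "f \<in> vcar E" "g \<in> vcar F" for c f g
  proof (rule form_eqI)
    show "B (vscale E c f) g \<in> vcar (dual (V \<otimes> W))" by (rule B_dual[OF cE(2) f(2)]) fact
    show "vscale (dual (V \<otimes> W)) c (B f g) \<in> vcar (dual (V \<otimes> W))" by (intro d B_dual f)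
    fix x y assume xy: "x \<in> vcar V" "y \<in> vcar W"
    show "B (vscale E c f) g (pure V W x y) = vscale (dual (V \<otimes> W)) c (B f g) (pure V W x y)"
      using P[OF cE(2)[OF f(1)] f(2) xy, of c] P[OF f xy]
      by (simp only: ds sE(2) pointwise_def mult.assoc)
  qed
  have 4: "B f (vscale F c g) = vscale (dual (V \<otimes> W)) c (B f g)"
    if f: "f \<in> vcar E" "g \<in> vcar F" for c f g
  proof (rule form_eqI)
    show "B f (vscale F c g) \<in> vcar (dual (V \<otimes> W))" by (rule B_dual[OF f(1) cF(2)]) fact
    show "vscale (dual (V \<otimes> W)) c (B f g) \<in> vcar (dual (V \<otimes> W))" by (intro d B_dual f)
    fix x y assume xy: "x \<in> vcar V" "y \<in> vcar W"
    show "B f (vscale F c g) (pure V W x y) = vscale (dual (V \<otimes> W)) c (B f g) (pure V W x y)"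
      using P[OF f(1) cF(2)[OF f(2)] xy, of c] P[OF f xy]
      by (simp only: ds sF(2) pointwise_def mult.left_commute)
  qed
  show ?thesis
    unfolding bilin_map_def lin_map_def using 1 2 3 4 B_dual by blast
qed

lemmas incl_properties =
  lift_properties[OF E F vspace_dual[OF vspace_tensor] bilin_B, folded dual_incl_def]

lemma dual_incl_pure:
  assumes "f \<in> vcar E" "g \<in> vcar F" "x \<in> vcar V" "y \<in> vcar W"
  shows "dual_incl V W E F (pure E F f g) (pure V W x y) = f x * g y"
  using assms by (simp add: incl_properties B_properties)

lemma tensor_representation:
  assumes "s \<in> vcar (E \<otimes> F)"
  shows "\<exists>T u. finite T \<and> T \<subseteq> vcar F \<and> pw.independent T \<and> (\<forall>e\<in>T. u e \<in> vcar E) \<and>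
    s = (\<Sum>e\<in>T. pure E F (u e) e)"
proof -
  obtain N where N: "N \<subseteq> vcar F" "pw.independent N" "vcar F \<subseteq> pw.span N"
    using pw.maximal_independent_subset[of "vcar F"] by blast
  have sN: "pw.span N \<subseteq> vcar F"
    using F pw.span_minimal[OF N(1)] by (simp add: vspace_def sF)
  note bl = bilin_pure[OF E F] and cE = vspace_closed[OF E] and cF = vspace_closed[OF F]
  have z1: "pure E F 0 e = 0" if "e \<in> vcar F" for e
    using bl that lin_map_zero[OF E] unfolding bilin_map_def by blast
  have z2: "pure E F f 0 = 0" if "f \<in> vcar E" for f
    using bl that lin_map_zero[OF F] unfolding bilin_map_def by blast
  have p1: "pure E F (f + f') e = pure E F f e + pure E F f' e"
    if "f \<in> vcar E" "f' \<in> vcar E" "e \<in> vcar F" for f f' e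
    using bl that unfolding bilin_map_def lin_map_def by blast
  have p2: "pure E F f (e + e') = pure E F f e + pure E F f e'"
    if "f \<in> vcar E" "e \<in> vcar F" "e' \<in> vcar F" for f e e'
    using bl that unfolding bilin_map_def lin_map_def by blast
  have p3: "pure E F f (pointwise c e) = pure E F (pointwise c f) e"
    if f: "f \<in> vcar E" "e \<in> vcar F" for f e c
  proof -
    have "pure E F f (vscale F c e) = vscale (E \<otimes> F) c (pure E F f e)"
      "pure E F (vscale E c f) e = vscale (E \<otimes> F) c (pure E F f e)"
      using bl f unfolding bilin_map_def lin_map_def by blast+
    then show ?thesis by (simp only: sE sF)
  qed
  define Q where "Q s \<longleftrightarrow> (\<exists>T u. finite T \<and> T \<subseteq> N \<and> (\<forall>e. u e \<in> vcar E) \<and>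
    (\<forall>e. e \<notin> T \<longrightarrow> u e = 0) \<and> s = (\<Sum>e\<in>T. pure E F (u e) e))" for s
  have Q0: "Q 0"
    unfolding Q_def by (rule exI[of _ "{}"], rule exI[of _ "\<lambda>_. 0"]) (simp add: cE(1))
  have Qa: "Q (s + t)" if "Q s" "Q t" for s t
  proof -
    obtain T u where T: "finite T" "T \<subseteq> N" "\<And>e. u e \<in> vcar E" "\<And>e. e \<notin> T \<Longrightarrow> u e = 0"
      "s = (\<Sum>e\<in>T. pure E F (u e) e)" using \<open>Q s\<close> unfolding Q_def by blast
    obtain S v where S: "finite S" "S \<subseteq> N" "\<And>e. v e \<in> vcar E" "\<And>e. e \<notin> S \<Longrightarrow> v e = 0"
      "t = (\<Sum>e\<in>S. pure E F (v e) e)" using \<open>Q t\<close> unfolding Q_def by blast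
    have NF: "e \<in> vcar F" if "e \<in> T \<union> S" for e using that T(2) S(2) N(1) by blast
    have "s = (\<Sum>e\<in>T \<union> S. pure E F (u e) e)" unfolding T(5)
      by (rule sum.mono_neutral_left) (use T(1,4) S(1) z1 NF in auto)
    moreover have "t = (\<Sum>e\<in>T \<union> S. pure E F (v e) e)" unfolding S(5)
      by (rule sum.mono_neutral_left) (use T(1) S(1,4) z1 NF in auto)
    ultimately have "s + t = (\<Sum>e\<in>T \<union> S. pure E F (u e) e + pure E F (v e) e)"
      by (simp only: sum.distrib)
    also have "\<dots> = (\<Sum>e\<in>T \<union> S. pure E F (u e + v e) e)"
      by (rule sum.cong[OF refl], rule p1[symmetric]) (use T(3) S(3) NF in blast)+
    finally show ?thesis
      unfolding Q_def using T(1-4) S(1-4) cE(2)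
      by (intro exI[of _ "T \<union> S"] exI[of _ "\<lambda>e. u e + v e"]) auto
  qed
  have Qp: "Q (pure E F f g)" if f: "f \<in> vcar E" and g: "g \<in> vcar F" for f g
  proof -
    have "g \<in> pw.span N" using g N(3) by blast
    then have "g \<in> pw.span N \<and> Q (pure E F f g)"
    proof (induction rule: pw.span_induct_alt)
      case base
      have "Q (pure E F f 0)" using Q0 z2[OF f] by (simp only:)
      with pw.span_zero show ?case by (rule conjI)
    next
      case (step c e g)
      have e: "e \<in> vcar F" "pointwise c e \<in> pw.span N"
        using step(1) N(1) pw.span_base pw.span_scale by blast+
      have cf: "pointwise c f \<in> vcar E" using cE(3)[OF f] by (simp only: sE)
      have "Q (pure E F (pointwise c f) e)"
        unfolding Q_def
        by (rule exI[of _ "{e}"], rule exI[of _ "\<lambda>e'. if e' = e then pointwise c f else 0"])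
          (use step(1) cf cE(1) in simp)
      then have "Q (pure E F f (pointwise c e))" by (simp only: p3[OF f e(1)])
      moreover have "Q (pure E F f g)" "g \<in> pw.span N" using step by blast+
      moreover have "pure E F f (pointwise c e + g) = pure E F f (pointwise c e) + pure E F f g"
        by (rule p2[OF f]) (use e \<open>g \<in> pw.span N\<close> sN in blast)+
      ultimately have "Q (pure E F f (pointwise c e + g))" using Qa by metis
      with pw.span_add[OF e(2) \<open>g \<in> pw.span N\<close>] show ?case by (rule conjI)
    qed
    then show ?thesis by simp
  qed
  have "Q s" using E F assms
  proof (induction rule: tensor_induct)
    case (pure x y) then show ?case by (rule Qp)
  next
    case (add s t) then show ?case by (intro Qa)
  qed
  then obtain T u where T: "finite T" "T \<subseteq> N" "\<And>e. u e \<in> vcar E"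
    "s = (\<Sum>e\<in>T. pure E F (u e) e)" unfolding Q_def by blast
  then show ?thesis
    using N(1) pw.independent_mono[OF N(2) T(2)]
    by (intro exI[of _ T] exI[of _ u]) auto
qed

lemma inj_on_dual_incl: "inj_on (dual_incl V W E F) (vcar (E \<otimes> F))"
proof -
  note cT = vspace_closed[OF vspace_tensor[of E F]]
  let ?i = "dual_incl V W E F"
  have lin: "lin_map (E \<otimes> F) (dual (V \<otimes> W)) ?i" by (rule incl_properties(1))
  have sub: "s - t \<in> vcar (E \<otimes> F)" if "s \<in> vcar (E \<otimes> F)" "t \<in> vcar (E \<otimes> F)" for s t
    using that pw.span_diff by (auto simp: tensor_def)
  have ker: "s = 0" if s: "s \<in> vcar (E \<otimes> F)" "?i s = 0" for s
  proof -
    obtain T u where T: "finite T" "T \<subseteq> vcar F" "pw.independent T" "\<And>e. e \<in> T \<Longrightarrow> u e \<in> vcar E"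
      and s_eq: "s = (\<Sum>e\<in>T. pure E F (u e) e)"
      using tensor_representation[OF s(1)] by blast
    have i_sum: "?i (\<Sum>e\<in>S. pure E F (u e) e) (pure V W x y) = (\<Sum>e\<in>S. u e x * e y) \<and>
        (\<Sum>e\<in>S. pure E F (u e) e) \<in> vcar (E \<otimes> F)"
      if "S \<subseteq> T" "x \<in> vcar V" "y \<in> vcar W" for S x y
      using finite_subset[OF that(1) T(1)] that
    proof (induction S rule: finite_induct)
      case empty
      have "?i 0 = 0" by (rule lin_map_zero[OF vspace_tensor lin])
      then have "?i (\<Sum>e\<in>{}. pure E F (u e) e) (pure V W x y) = (\<Sum>e\<in>{}. u e x * e y) \<and>
          (\<Sum>e\<in>{}. pure E F (u e) e) \<in> vcar (E \<otimes> F)"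
        using cT(1) by (simp only: sum.empty zero_fun_apply)
      then show ?case .
    next
      case (insert e S)
      let ?p = "pure E F (u e) e" and ?q = "\<Sum>e\<in>S. pure E F (u e) e"
      have p: "?p \<in> vcar (E \<otimes> F)" using insert T by (auto intro!: pure_in_tensor)
      have q: "?q \<in> vcar (E \<otimes> F)" "?i ?q (pure V W x y) = (\<Sum>e\<in>S. u e x * e y)"
        using insert by auto
      have "?i (?p + ?q) = ?i ?p + ?i ?q" using lin p q by (auto simp: lin_map_def)
      moreover have "?i ?p (pure V W x y) = u e x * e y"
        using dual_incl_pure insert T by auto
      ultimately have "?i (\<Sum>e\<in>insert e S. pure E F (u e) e) (pure V W x y) =
          (\<Sum>e\<in>insert e S. u e x * e y) \<and>
          (\<Sum>e\<in>insert e S. pure E F (u e) e) \<in> vcar (E \<otimes> F)"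
        using q cT(2)[OF p q(1)]
        by (simp only: sum.insert[OF insert(1,2)] plus_fun_apply simp_thms)
      then show ?case .
    qed
    have "u e x = 0" if e: "e \<in> T" and x: "x \<in> vcar V" for e x
    proof -
      have "(\<Sum>e\<in>T. pointwise (u e x) e) = 0"
      proof
        fix y
        have "(\<Sum>e\<in>T. pointwise (u e x) e) y = (\<Sum>e\<in>T. u e x * e y)"
          using T(1) by (induction T rule: finite_induct) (simp_all add: pointwise_def)
        also have "\<dots> = 0"
        proof (cases "y \<in> vcar W")
          case True
          then show ?thesis using i_sum[OF subset_refl x True] s s_eq by simp
        next
          case False
          then have "e y = 0" if "e \<in> T" for e using that T(2) sF by (auto simp: dual_def)
          then show ?thesis by (intro sum.neutral) simp
        qed
        finally show "(\<Sum>e\<in>T. pointwise (u e x) e) y = 0 y" by simp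
      qed
      then show ?thesis
        by (rule pw.independentD[OF T(3,1) subset_refl _ e, where u = "\<lambda>e. u e x"])
    qed
    then have "u e = 0" if "e \<in> T" for e
      using T(4)[OF that] sE that by (auto simp: dual_def fun_eq_iff)
    moreover have "pure E F 0 e = 0" if "e \<in> T" for e
      using bilin_pure[OF E F] that T(2) lin_map_zero[OF E]
      by (auto simp: bilin_map_def dest!: bspec[of "vcar F" _ e])
    ultimately show "s = 0" unfolding s_eq by (intro sum.neutral) simp
  qed
  show ?thesis
  proof (rule inj_onI)
    fix s t assume st: "s \<in> vcar (E \<otimes> F)" "t \<in> vcar (E \<otimes> F)" "?i s = ?i t"
    have "?i s = ?i (s - t + t)" by simp
    also have "\<dots> = ?i (s - t) + ?i t" using lin sub[OF st(1,2)] st(2) unfolding lin_map_def by blast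
    finally have "?i (s - t) = 0" using st(3) by simp
    then show "s = t" using ker[OF sub[OF st(1,2)]] by simp
  qed
qed

end

end

(* If \<xi> kills M\<cdot>J for a cofinite ideal J, then (m, g) \<mapsto> \<xi>(m\<cdot>g) kills M \<otimes> J, so expanding g in
   coordinates modulo J writes it as a finite sum of products \<xi>(_\<cdot>c) \<otimes> e with e in the Sweedler
   dual of G. Surjectivity of \<beta> puts the left factors in the Sweedler dual of M: if c = \<beta>(z),
   then (m\<cdot>j)\<cdot>c = \<kappa>(m)\<cdot>(j z) lies in M\<cdot>J, so \<xi>(_\<cdot>c) kills M\<cdot>J.
   The comodule identities can be tested on pure tensors of M and G, since tensor products of
   spaces of functionals embed into duals of tensor products; there they are \<xi> applied to the
   module identities. The coalgebra identities are those of G acting on itself. *)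

theory Submission
  imports Defs
begin

section \<open>Linear maps\<close>

lemma lin_map_comp: "lin_map U V f \<Longrightarrow> lin_map V W g \<Longrightarrow> lin_map U W (\<lambda>x. g (f x))"
  by (simp add: lin_map_def)

lemma lin_map_eval: "lin_map (dual V) ground (\<lambda>f. f x)"
  by (simp add: lin_map_def dual_def ground_def pointwise_def)

lemma lin_map_mult_right: "lin_map U ground f \<Longrightarrow> lin_map U ground (\<lambda>x. f x * c)"
  by (simp add: lin_map_def ground_def distrib_right mult.assoc)

lemma lin_map_in: "lin_map V W f \<Longrightarrow> x \<in> vcar V \<Longrightarrow> f x \<in> vcar W"
  by (simp add: lin_map_def)

lemma lin_map_id: "lin_map V V (\<lambda>x. x)"
  by (simp add: lin_map_def)

lemma lin_map_pure_left:
  "vspace V \<Longrightarrow> vspace W \<Longrightarrow> y \<in> vcar W \<Longrightarrow> lin_map V (V \<otimes> W) (\<lambda>x. pure V W x y)"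
  using bilin_pure[of V W] by (simp add: bilin_map_def)

lemma lin_map_pure_right:
  "vspace V \<Longrightarrow> vspace W \<Longrightarrow> x \<in> vcar V \<Longrightarrow> lin_map W (V \<otimes> W) (pure V W x)"
  using bilin_pure[of V W] by (simp add: bilin_map_def)

lemma vspace_sum:
  assumes "vspace V" "\<And>i. i \<in> I \<Longrightarrow> f i \<in> vcar V"
  shows "sum f I \<in> vcar V"
  using assms(2)
  by (induction I rule: infinite_finite_induct) (simp_all add: vspace_closed(1,2)[OF assms(1)])

lemma vspace_diff:
  assumes "vspace V" "x \<in> vcar V" "y \<in> vcar V"
  shows "x - y \<in> vcar V"
proof -
  interpret vector_space "vscale V" using assms by (simp add: vspace_def)
  show ?thesis using assms subspace_diff by (simp add: vspace_def)
qed

lemma lin_map_sum: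
  assumes "vspace V" "lin_map V W h" "\<And>i. i \<in> I \<Longrightarrow> f i \<in> vcar V"
  shows "h (sum f I) = (\<Sum>i\<in>I. h (f i))"
  using assms(3)
proof (induction I rule: infinite_finite_induct)
  case (insert i I)
  then have "sum f I \<in> vcar V" by (intro vspace_sum assms(1)) auto
  then show ?case using insert assms(2) by (simp add: lin_map_def)
qed (simp_all add: lin_map_zero[OF assms(1,2)])

lemma lin_map_diff:
  assumes "vspace V" "lin_map V W h" "x \<in> vcar V" "y \<in> vcar V"
  shows "h (x - y) = h x - h y"
proof -
  have "h (x - y + y) = h (x - y) + h y"
    using assms(2,4) vspace_diff[OF assms(1,3,4)] unfolding lin_map_def by blast
  then show ?thesis by simp
qed

text \<open>Together with the linear inverse below, this allows an abstract space to be replaced by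
  its isomorphic image inside a dual, where the results on \<open>dual_pair\<close> apply.\<close>

lemma vspace_image:
  assumes V: "vspace V" and W: "vspace W" and f: "lin_map V W f"
  shows "vspace (W\<lparr>vcar := f ` vcar V\<rparr>)"
proof -
  interpret vector_space "vscale W" using W by (simp add: vspace_def)
  note cl = vspace_closed[OF V]
  have "subspace (f ` vcar V)"
  proof (rule subspaceI)
    show "0 \<in> f ` vcar V" using lin_map_zero[OF V f] cl(1) by force
    fix x y c assume x: "x \<in> f ` vcar V"
    show "x + y \<in> f ` vcar V" if "y \<in> f ` vcar V"
    proof -
      from x that obtain u v where "x = f u" "y = f v" "u \<in> vcar V" "v \<in> vcar V" by blast
      then show ?thesis using f cl(2)[of u v] by (intro image_eqI[of _ _ "u + v"]) (simp_all add: lin_map_def)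
    qed
    from x obtain u where "x = f u" "u \<in> vcar V" by blast
    then show "vscale W c x \<in> f ` vcar V"
      using f cl(3)[of u c] by (intro image_eqI[of _ _ "vscale V c u"]) (simp_all add: lin_map_def)
  qed
  then show ?thesis using W by (simp add: vspace_def)
qed

lemma lin_map_the_inv_into:
  assumes V: "vspace V" and f: "lin_map V W f" and inj: "inj_on f (vcar V)"
  shows "lin_map (W\<lparr>vcar := f ` vcar V\<rparr>) V (the_inv_into (vcar V) f)"
proof -
  let ?g = "the_inv_into (vcar V) f"
  note cl = vspace_closed[OF V] and gf = the_inv_into_f_f[OF inj]
  have 1: "?g (f u + f v) = ?g (f u) + ?g (f v)" if "u \<in> vcar V" "v \<in> vcar V" for u v
  proof -
    have "f u + f v = f (u + v)" using f that by (simp add: lin_map_def)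
    then show ?thesis using that cl(2)[OF that] by (simp add: gf)
  qed
  have 2: "?g (vscale W c (f u)) = vscale V c (?g (f u))" if "u \<in> vcar V" for c u
  proof -
    have "vscale W c (f u) = f (vscale V c u)" using f that by (simp add: lin_map_def)
    then show ?thesis using that cl(3)[OF that] by (simp add: gf)
  qed
  show ?thesis unfolding lin_map_def using 1 2 by (auto simp: gf)
qed

lemma dual_map_in_dual:
  assumes "vspace V" "lin_map V W h" "f \<in> vcar (dual W)"
  shows "dual_map V h f \<in> vcar (dual V)"
proof -
  have "lin_map V ground (\<lambda>x. f (h x))" 
    by (rule lin_map_comp[OF assms(2)]) (use assms(3) in \<open>simp add: dual_def\<close>)
  then have "lin_map V ground (dual_map V h f)"
    by (rule lin_map_cong[OF assms(1)]) (simp add: dual_map_def)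
  then show ?thesis by (simp add: dual_def dual_map_def)
qed

text \<open>Precomposition is computed pointwise, so it respects sums and multiples of functionals;
  only stability of \<open>E\<close> has to be supplied.\<close>

lemma lin_map_dual_map:
  assumes "vscale E = pointwise" "\<And>e. e \<in> vcar E \<Longrightarrow> dual_map V h e \<in> vcar E"
  shows "lin_map E E (dual_map V h)"
  unfolding lin_map_def assms(1) using assms(2)
  by (simp add: fun_eq_iff) (simp add: dual_map_def pointwise_def)


section \<open>Subspaces of finite codimension\<close>

text \<open>A basis of \<open>J\<close> extends to a basis of \<open>W\<close> by finitely many
  vectors \<open>C\<close>; their coordinate functionals \<open>g\<close> kill \<open>J\<close>, and
  subtracting the \<open>C\<close>-part of a vector leaves a combination of basis vectors of
  \<open>J\<close>.\<close>

lemma finite_codim_coordinates: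
  assumes W: "vspace W" and J: "J \<subseteq> vcar W" "module.subspace (vscale W) J" "finite_codim W J"
  obtains C g where "finite C" "C \<subseteq> vcar W"
    "\<forall>c\<in>C. g c \<in> vcar (dual W)" "\<forall>c\<in>C. \<forall>j\<in>J. g c j = 0"
    "\<forall>w\<in>vcar W. w - (\<Sum>c\<in>C. vscale W (g c w) c) \<in> J"
proof -
  interpret vector_space "vscale W" using W by (simp add: vspace_def)
  have sW: "subspace (vcar W)" using W by (simp add: vspace_def)
  note sJ = J(2)
  obtain B where B: "finite B" "B \<subseteq> vcar W" "\<And>x. x \<in> vcar W \<Longrightarrow> \<exists>b\<in>span B. x - b \<in> J"
    using J(3) unfolding finite_codim_def by blast
  obtain K where K: "K \<subseteq> J" "independent K" "J \<subseteq> span K"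
    using maximal_independent_subset[of J] by blast
  have KJ: "span K = J" using K span_minimal[OF K(1) sJ] by blast
  \<comment> \<open>Bounding the basis \<open>D\<close> by \<open>K \<union> B\<close> makes the set
    of new vectors \<open>D - K\<close> finite, being contained in \<open>B\<close>.\<close>
  obtain D where D: "K \<subseteq> D" "D \<subseteq> K \<union> B" "independent D" "K \<union> B \<subseteq> span D"
    using maximal_independent_subset_extend[of K "K \<union> B"] K(2) by blast
  have DW: "D \<subseteq> vcar W" using D(2) K(1) J(1) B(2) by blast
  have WD: "w \<in> span D" if "w \<in> vcar W" for w
  proof -
    obtain b where b: "b \<in> span B" "w - b \<in> J" using B(3) \<open>w \<in> vcar W\<close> by blast
    have "b \<in> span D" "w - b \<in> span D"
      using b K(3) D(4) span_minimal[of B "span D"] span_mono[OF D(1)] by blast+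
    then show ?thesis using span_add[of b D "w - b"] by simp
  qed
  define C where "C = D - K"
  \<comment> \<open>The value 0 off the carrier is the normalisation that membership in
    \<open>dual W\<close> requires.\<close>
  define g where "g c w = (if w \<in> vcar W then representation D w c else 0)" for c w
  show thesis
  proof
    show "finite C" using D(2) B(1) by (auto simp: C_def intro: finite_subset[of _ B])
    show "C \<subseteq> vcar W" using DW by (auto simp: C_def)
    show "\<forall>c\<in>C. g c \<in> vcar (dual W)"
      using WD subspace_add[OF sW] subspace_scale[OF sW]
      by (auto simp: dual_def lin_map_def ground_def g_def representation_add[OF D(3)]
          representation_scale[OF D(3)])
    show "\<forall>c\<in>C. \<forall>j\<in>J. g c j = 0"
    proof (intro ballI)
      fix c j assume *: "c \<in> C" "j \<in> J"
      \<comment> \<open>A vector in the span of \<open>K\<close> has the same coordinates in the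
        larger basis, hence none along \<open>c\<close>, which is not in \<open>K\<close>.\<close>
      have "representation D j = representation K j"
        by (rule representation_extend[OF D(3)]) (use K(3) D(1) * in auto)
      then show "g c j = 0"
        using representation_ne_zero[of K j c] * by (auto simp: g_def C_def)
    qed
    show "\<forall>w\<in>vcar W. w - (\<Sum>c\<in>C. vscale W (g c w) c) \<in> J"
    proof
      fix w assume w: "w \<in> vcar W"
      let ?r = "representation D w"
      let ?S = "{b. ?r b \<noteq> 0}"
      have fS: "finite ?S" by (rule finite_representation)
      have SD: "?S \<subseteq> D" using representation_ne_zero by blast
      have fC: "finite C" by fact
      have "w = (\<Sum>b\<in>?S. vscale W (?r b) b)"
        using sum_nonzero_representation_eq[OF D(3) WD[OF w]] by simp
      \<comment> \<open>The terms over \<open>K\<close> form the remainder in \<open>J\<close>; the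
        others are the expansion along \<open>C\<close>, where vanishing coordinates may be added
        freely.\<close>
      also have "\<dots> = (\<Sum>b\<in>?S \<inter> K. vscale W (?r b) b) + (\<Sum>b\<in>?S - K. vscale W (?r b) b)"
        by (rule sum.Int_Diff[OF fS])
      also have "(\<Sum>b\<in>?S - K. vscale W (?r b) b) = (\<Sum>c\<in>C. vscale W (g c w) c)"
        by (rule sum.mono_neutral_cong_left[OF fC]) (use SD w in \<open>auto simp: C_def g_def\<close>)
      finally have "w - (\<Sum>c\<in>C. vscale W (g c w) c) = (\<Sum>b\<in>?S \<inter> K. vscale W (?r b) b)"
        by (simp add: algebra_simps)
      moreover have "\<dots> \<in> J"
        by (rule subspace_sum[OF sJ]) (use K(1) subspace_scale[OF sJ] in auto)
      ultimately show "w - (\<Sum>c\<in>C. vscale W (g c w) c) \<in> J" by simp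
    qed
  qed
qed

text \<open>Modulo \<open>H\<close>, any vector is reached from \<open>B\<close>. The error lies in
  \<open>H\<close>, and modulo \<open>J\<close> it is represented in the finite-dimensional span of
  \<open>C\<close>; lifting such representatives back into \<open>H\<close> corrects the error
  modulo both subspaces at once.\<close>

lemma finite_codim_Int:
  assumes V: "vspace V"
    and H: "H \<subseteq> vcar V" "module.subspace (vscale V) H" "finite_codim V H"
    and J: "module.subspace (vscale V) J" "finite_codim V J"
  shows "finite_codim V (H \<inter> J)"
proof -
  interpret vector_space "vscale V" using V by (simp add: vspace_def)
  obtain B where B: "finite B" "B \<subseteq> vcar V" "\<And>x. x \<in> vcar V \<Longrightarrow> \<exists>b\<in>span B. x - b \<in> H"
    using H(3) unfolding finite_codim_def by blast
  obtain C where C: "finite C" "C \<subseteq> vcar V" "\<And>x. x \<in> vcar V \<Longrightarrow> \<exists>b\<in>span C. x - b \<in> J"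
    using J(2) unfolding finite_codim_def by blast
  \<comment> \<open>\<open>P\<close> consists of the representatives in the span of \<open>C\<close>
    that agree modulo \<open>J\<close> with some element of \<open>H\<close>.\<close>
  define P where "P = {b \<in> span C. \<exists>x\<in>H. x - b \<in> J}"
  obtain D where D: "D \<subseteq> P" "independent D" "P \<subseteq> span D"
    using maximal_independent_subset[of P] by blast
  have fD: "finite D" using independent_span_bound[OF C(1) D(2)] D(1) by (auto simp: P_def)
  have "\<exists>x\<in>H. x - d \<in> J" if "d \<in> D" for d using that D(1) by (auto simp: P_def)
  \<comment> \<open>\<open>y\<close> lifts a basis of \<open>P\<close> into \<open>H\<close>; with
    \<open>B\<close>, its finitely many values will span a complement modulo the
    intersection.\<close>
  then obtain y where y: "\<And>d. d \<in> D \<Longrightarrow> y d \<in> H" "\<And>d. d \<in> D \<Longrightarrow> y d - d \<in> J" by metis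
  have yH: "span (y ` D) \<subseteq> H" by (rule span_minimal[OF _ H(2)]) (use y(1) in blast)
  have approx: "\<exists>z\<in>span (y ` D). z - b \<in> J" if "b \<in> span D" for b
    using that
  proof (induction rule: span_induct_alt)
    case base
    show ?case by (rule bexI[of _ 0]) (simp_all add: span_zero subspace_0[OF J(1)])
  next
    case (step c d b)
    then obtain z where z: "z \<in> span (y ` D)" "z - b \<in> J" by blast
    have "vscale V c (y d) + z - (vscale V c d + b) = vscale V c (y d - d) + (z - b)"
      by (simp add: scale_right_diff_distrib)
    moreover have "\<dots> \<in> J"
      by (intro subspace_add[OF J(1)] subspace_scale[OF J(1)] y(2) z(2) step(1))
    moreover have "vscale V c (y d) + z \<in> span (y ` D)"
      by (intro span_add span_scale span_base imageI step(1) z(1))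
    ultimately show ?case by (intro bexI[of _ "vscale V c (y d) + z"]) (simp_all only:)
  qed
  show ?thesis
    unfolding finite_codim_def
  proof (intro exI[of _ "B \<union> y ` D"] conjI ballI)
    show "finite (B \<union> y ` D)" using B fD by blast
    show "B \<union> y ` D \<subseteq> vcar V" using B(2) y(1) H(1) by blast
    fix x assume x: "x \<in> vcar V"
    obtain b where b: "b \<in> span B" "x - b \<in> H" using B(3) x by blast
    \<comment> \<open>The error \<open>x - b\<close> lies in \<open>H\<close> and witnesses that
      \<open>c\<close> belongs to \<open>P\<close>, so \<open>c\<close> can be lifted.\<close>
    obtain c where c: "c \<in> span C" "x - b - c \<in> J" using C(3) H(1) b(2) by blast
    have "c \<in> span D" using D(3) b c by (auto simp: P_def)
    then obtain z where z: "z \<in> span (y ` D)" "z - c \<in> J" using approx by blast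
    have "x - (b + z) \<in> H"
      using subspace_diff[OF H(2) b(2), of z] yH z(1) by (auto simp: algebra_simps)
    moreover have "x - (b + z) \<in> J"
      using subspace_diff[OF J(1) c(2) z(2)] by (simp add: algebra_simps)
    moreover have "b + z \<in> span (B \<union> y ` D)"
      using b(1) z(1) span_mono[of B "B \<union> y ` D"] span_mono[of "y ` D" "B \<union> y ` D"]
      by (intro span_add) auto
    ultimately show "\<exists>b\<in>span (B \<union> y ` D). x - b \<in> H \<inter> J" by blast
  qed
qed


section \<open>Tensor products of dual spaces\<close>

context dual_pair
begin

text \<open>The inclusion is injective, and functionals on \<open>V \<otimes> W\<close> are
  determined by pure tensors. This is the test by which identities in \<open>E \<otimes> F\<close>
  are verified.\<close>

lemma dual_incl_eqI:
  assumes "s \<in> vcar (E \<otimes> F)" "t \<in> vcar (E \<otimes> F)"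
    and "\<And>x y. x \<in> vcar V \<Longrightarrow> y \<in> vcar W \<Longrightarrow>
      dual_incl V W E F s (pure V W x y) = dual_incl V W E F t (pure V W x y)"
  shows "s = t"
  by (rule inj_onD[OF inj_on_dual_incl _ assms(1,2)])
    (intro form_eqI lin_map_in[OF incl_properties(1)] assms)

text \<open>A form killing \<open>V \<otimes> J\<close> has finite rank: expand its second argument in coordinates modulo
  the finite-codimensional subspace \<open>J\<close>.\<close>

lemma dual_incl_image:
  assumes p: "p \<in> vcar (dual (V \<otimes> W))"
    and J: "J \<subseteq> vcar W" "module.subspace (vscale W) J" "finite_codim W J"
    and pJ: "\<And>x j. x \<in> vcar V \<Longrightarrow> j \<in> J \<Longrightarrow> p (pure V W x j) = 0"
    and pE: "\<And>y. y \<in> vcar W \<Longrightarrow> dual_map V (\<lambda>x. pure V W x y) p \<in> vcar E"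
    and JF: "\<And>f. f \<in> vcar (dual W) \<Longrightarrow> (\<And>j. j \<in> J \<Longrightarrow> f j = 0) \<Longrightarrow> f \<in> vcar F"
  shows "p \<in> dual_incl V W E F ` vcar (E \<otimes> F)"
proof -
  obtain C g where C: "finite C" "C \<subseteq> vcar W"
    "\<forall>c\<in>C. g c \<in> vcar (dual W)" "\<forall>c\<in>C. \<forall>j\<in>J. g c j = 0"
    "\<forall>w\<in>vcar W. w - (\<Sum>c\<in>C. vscale W (g c w) c) \<in> J"
    by (rule finite_codim_coordinates[OF W J])
  let ?e = "\<lambda>c. dual_map V (\<lambda>x. pure V W x c) p"
  \<comment> \<open>The candidate preimage pairs the slice of \<open>p\<close> at \<open>c\<close>
    with the coordinate functional of \<open>c\<close>.\<close>
  let ?t = "\<Sum>c\<in>C. pure E F (?e c) (g c)"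
  have eE: "?e c \<in> vcar E" and gF: "g c \<in> vcar F" if "c \<in> C" for c
    using that C pE JF by blast+
  have t: "pure E F (?e c) (g c) \<in> vcar (E \<otimes> F)" if "c \<in> C" for c
    using that by (intro pure_in_tensor eE gF)
  have tt: "?t \<in> vcar (E \<otimes> F)" by (intro vspace_sum vspace_tensor t)
  have "p = dual_incl V W E F ?t"
  proof (rule form_eqI)
    show "p \<in> vcar (dual (V \<otimes> W))" by (rule p)
    show "dual_incl V W E F ?t \<in> vcar (dual (V \<otimes> W))"
      by (rule lin_map_in[OF incl_properties(1) tt])
    fix x y assume x: "x \<in> vcar V" and y: "y \<in> vcar W"
    let ?y = "\<Sum>c\<in>C. vscale W (g c y) c"
    have px: "lin_map W ground (\<lambda>y. p (pure V W x y))"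
      by (rule lin_map_comp[OF lin_map_pure_right[OF V W x]]) (use p in \<open>simp add: dual_def\<close>)
    have cW: "vscale W a c \<in> vcar W" if "c \<in> C" for a c
      using C(2) that vspace_closed(3)[OF W] by blast
    have yW: "?y \<in> vcar W" by (intro vspace_sum W cW)
    \<comment> \<open>The difference between \<open>y\<close> and its expansion lies in
      \<open>J\<close>, so \<open>p\<close> cannot distinguish the two.\<close>
    have "p (pure V W x (y - ?y)) = 0" by (rule pJ[OF x bspec[OF C(5) y]])
    then have "p (pure V W x y) = p (pure V W x ?y)"
      using lin_map_diff[OF W px y yW] by simp
    also have "\<dots> = (\<Sum>c\<in>C. p (pure V W x (vscale W (g c y) c)))"
      by (rule lin_map_sum[OF W px cW])
    also have "\<dots> = (\<Sum>c\<in>C. ?e c x * g c y)"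
      using px C(2) x by (intro sum.cong) (auto simp: lin_map_def ground_def dual_map_def)
    also have "\<dots> = (\<Sum>c\<in>C. dual_incl V W E F (pure E F (?e c) (g c)) (pure V W x y))"
      by (intro sum.cong refl dual_incl_pure[symmetric] eE gF x y)
    also have "\<dots> = dual_incl V W E F ?t (pure V W x y)"
      by (rule lin_map_sum[OF vspace_tensor lin_map_comp[OF incl_properties(1) lin_map_eval] t,
            symmetric])
    finally show "p (pure V W x y) = dual_incl V W E F ?t (pure V W x y)" .
  qed
  with tt show ?thesis by blast
qed

end

text \<open>\<open>X\<close> is identified with its image under \<open>\<iota>\<close>; applied to \<open>X = F \<otimes> F\<close> this embeds
  \<open>E \<otimes> (F \<otimes> F)\<close> into the dual of a threefold tensor product.\<close>

lemma dual_incl_extend: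
  fixes E :: "('k::field, 'a::ab_group_add \<Rightarrow> 'k) vsp" and \<iota> :: "'x::ab_group_add \<Rightarrow> 'b::ab_group_add \<Rightarrow> 'k"
  assumes V: "vspace V" and Y: "vspace Y" and E: "vspace E" and X: "vspace X"
    and sE: "vcar E \<subseteq> vcar (dual V)" "vscale E = pointwise"
    and \<iota>: "lin_map X (dual Y) \<iota>" "inj_on \<iota> (vcar X)"
  obtains h where "lin_map (E \<otimes> X) (dual (V \<otimes> Y)) h" "inj_on h (vcar (E \<otimes> X))"
    "\<forall>e\<in>vcar E. \<forall>x\<in>vcar X. \<forall>v\<in>vcar V. \<forall>y\<in>vcar Y.
      h (pure E X e x) (pure V Y v y) = e v * \<iota> x y"
proof -
  \<comment> \<open>The image of \<iota> is a genuine space of functionals on \<open>Y\<close>, so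
    \<open>dual_pair\<close> applies to \<open>E\<close> and \<open>X'\<close>.\<close>
  define X' where "X' = (dual Y)\<lparr>vcar := \<iota> ` vcar X\<rparr>"
  have X': "vspace X'" unfolding X'_def by (rule vspace_image[OF X vspace_dual[OF Y] \<iota>(1)])
  have \<iota>': "lin_map X X' \<iota>" using \<iota>(1) by (simp add: lin_map_def X'_def)
  interpret dual_pair V Y E X'
    using \<iota>(1) by unfold_locales
      (use V Y E X' sE in \<open>auto simp: X'_def lin_map_def dual_def\<close>)
  let ?k = "the_inv_into (vcar X) \<iota>"
  let ?f = "tmap E X E X' (\<lambda>x. x) \<iota>" and ?g = "tmap E X' E X (\<lambda>x. x) ?k"
  have k: "lin_map X' X ?k" unfolding X'_def by (rule lin_map_the_inv_into[OF X \<iota>])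
  note f = tmap_properties[OF E X E X' lin_map_id \<iota>']
  note g = tmap_properties[OF E X' E X lin_map_id k]
  \<comment> \<open>Tensoring the inverse of \<iota> with the identity gives a left inverse, so
    \<open>?f\<close> is injective on \<open>E \<otimes> X\<close>.\<close>
  have gf: "?g (?f t) = t" if "t \<in> vcar (E \<otimes> X)" for t
  proof (rule tensor_map_unique[OF E X _ _ _ that, where h' = "\<lambda>t. t"])
    show "lin_map (E \<otimes> X) (E \<otimes> X) (\<lambda>t. ?g (?f t))" by (rule lin_map_comp[OF f(1) g(1)])
    show "lin_map (E \<otimes> X) (E \<otimes> X) (\<lambda>t. t)" by (rule lin_map_id)
    fix e x assume "e \<in> vcar E" "x \<in> vcar X"
    then show "?g (?f (pure E X e x)) = pure E X e x"
      using lin_map_in[OF \<iota>', of x] by (simp add: f(2) g(2) the_inv_into_f_f[OF \<iota>(2)])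
  qed
  show thesis
  proof
    let ?h = "\<lambda>t. dual_incl V Y E X' (?f t)"
    show "lin_map (E \<otimes> X) (dual (V \<otimes> Y)) ?h" by (rule lin_map_comp[OF f(1) incl_properties(1)])
    show "inj_on ?h (vcar (E \<otimes> X))"
    proof (rule inj_onI)
      fix s t assume "s \<in> vcar (E \<otimes> X)" "t \<in> vcar (E \<otimes> X)" "?h s = ?h t"
      then have "?f s = ?f t" using inj_onD[OF inj_on_dual_incl] lin_map_in[OF f(1)] by blast
      then show "s = t" using gf \<open>s \<in> _\<close> \<open>t \<in> _\<close> by metis
    qed
    show "\<forall>e\<in>vcar E. \<forall>x\<in>vcar X. \<forall>v\<in>vcar V. \<forall>y\<in>vcar Y.
        ?h (pure E X e x) (pure V Y v y) = e v * \<iota> x y"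
      using lin_map_in[OF \<iota>'] by (simp add: f(2) dual_incl_pure)
  qed
qed


section \<open>Dualising an action\<close>

text \<open>Here \<gamma> is the transpose of \<rho>, pinned down by its values on pure tensors. The
  same setting covers the comultiplication (\<open>G\<close> acting on itself) and the coaction of
  the module dual.\<close>

locale dual_coaction = dual_pair V W E F
  for V :: "('k::field, 'a::ab_group_add) vsp" and W :: "('k, 'b::ab_group_add) vsp" and E F +
  fixes \<rho> :: "('k, 'a, 'b) tensor \<Rightarrow> 'a" and \<gamma> :: "('a \<Rightarrow> 'k) \<Rightarrow> ('k, 'a \<Rightarrow> 'k, 'b \<Rightarrow> 'k) tensor"
  assumes action_lin: "lin_map (V \<otimes> W) V \<rho>"
    and coaction_in: "e \<in> vcar E \<Longrightarrow> \<gamma> e \<in> vcar (E \<otimes> F)"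
    and coaction_eval: "e \<in> vcar E \<Longrightarrow> x \<in> vcar V \<Longrightarrow> y \<in> vcar W \<Longrightarrow>
      dual_incl V W E F (\<gamma> e) (pure V W x y) = e (\<rho> (pure V W x y))"
begin

text \<open>Linearity is forced: the values of \<gamma> \<open>e\<close> at pure tensors are linear
  in \<open>e\<close> and determine \<gamma> \<open>e\<close>.\<close>

lemma coaction_lin: "lin_map E (E \<otimes> F) \<gamma>"
  unfolding lin_map_def
proof (intro conjI ballI allI)
  note cE = vspace_closed[OF E] and cT = vspace_closed[OF vspace_tensor[of E F]]
  have L: "lin_map (E \<otimes> F) ground (\<lambda>s. dual_incl V W E F s t)" for t
    by (rule lin_map_comp[OF incl_properties(1) lin_map_eval])
  fix d assume d: "d \<in> vcar E"
  show "\<gamma> d \<in> vcar (E \<otimes> F)" by (rule coaction_in[OF d])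
  show "\<gamma> (d + e) = \<gamma> d + \<gamma> e" if e: "e \<in> vcar E" for e
  proof (rule dual_incl_eqI)
    show "\<gamma> (d + e) \<in> vcar (E \<otimes> F)" "\<gamma> d + \<gamma> e \<in> vcar (E \<otimes> F)"
      by (intro coaction_in cE cT d e)+
    fix x y assume "x \<in> vcar V" "y \<in> vcar W"
    then show "dual_incl V W E F (\<gamma> (d + e)) (pure V W x y) =
        dual_incl V W E F (\<gamma> d + \<gamma> e) (pure V W x y)"
      using L d e coaction_in cE(2)[OF d e]
      by (simp only: lin_map_def coaction_eval plus_fun_apply)
  qed
  show "\<gamma> (vscale E c d) = vscale (E \<otimes> F) c (\<gamma> d)" for c
  proof (rule dual_incl_eqI)
    show "\<gamma> (vscale E c d) \<in> vcar (E \<otimes> F)" "vscale (E \<otimes> F) c (\<gamma> d) \<in> vcar (E \<otimes> F)"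
      by (intro coaction_in cE cT d)+
    fix x y assume "x \<in> vcar V" "y \<in> vcar W"
    then show "dual_incl V W E F (\<gamma> (vscale E c d)) (pure V W x y) =
        dual_incl V W E F (vscale (E \<otimes> F) c (\<gamma> d)) (pure V W x y)"
      using L d coaction_in cE(3)[OF d]
      by (simp add: lin_map_def coaction_eval) (simp add: sE(2) ground_def pointwise_def)
  qed
qed

lemma action_in: "x \<in> vcar V \<Longrightarrow> y \<in> vcar W \<Longrightarrow> \<rho> (pure V W x y) \<in> vcar V"
  by (intro lin_map_in[OF action_lin] pure_in_tensor)

text \<open>Transposing \<sigma> and \<psi> moves them onto the arguments \<open>x\<close> and
  \<open>y\<close>, where the hypothesis on \<rho> applies. All compatibilities of structure maps
  with \<Delta> and the coaction are instances.\<close>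

lemma coaction_equivariant:
  assumes \<sigma>: "lin_map V V \<sigma>" and \<psi>: "lin_map W W \<psi>"
    and \<sigma>E: "lin_map E E (dual_map V \<sigma>)" and \<psi>F: "lin_map F F (dual_map W \<psi>)"
    and equiv: "\<And>x y. x \<in> vcar V \<Longrightarrow> y \<in> vcar W \<Longrightarrow>
      \<rho> (pure V W (\<sigma> x) (\<psi> y)) = \<sigma> (\<rho> (pure V W x y))"
    and e: "e \<in> vcar E"
  shows "tmap E F E F (dual_map V \<sigma>) (dual_map W \<psi>) (\<gamma> e) = \<gamma> (dual_map V \<sigma> e)"
proof (rule dual_incl_eqI)
  let ?T = "tmap E F E F (dual_map V \<sigma>) (dual_map W \<psi>)"
  note T = tmap_properties[OF E F E F \<sigma>E \<psi>F]
  show "?T (\<gamma> e) \<in> vcar (E \<otimes> F)" "\<gamma> (dual_map V \<sigma> e) \<in> vcar (E \<otimes> F)"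
    by (intro lin_map_in[OF T(1)] lin_map_in[OF \<sigma>E] coaction_in e)+
  fix x y assume x: "x \<in> vcar V" and y: "y \<in> vcar W"
  note xy = x y lin_map_in[OF \<sigma> x] lin_map_in[OF \<psi> y]
  have "dual_incl V W E F (?T (\<gamma> e)) (pure V W x y) =
      dual_incl V W E F (\<gamma> e) (pure V W (\<sigma> x) (\<psi> y))"
  \<comment> \<open>\<gamma> \<open>e\<close> need not be pure; both sides are linear in it, so pure
    tensors of functionals suffice.\<close>
  proof (rule tensor_map_unique[OF E F _ _ _ coaction_in[OF e]])
    show "lin_map (E \<otimes> F) ground (\<lambda>s. dual_incl V W E F (?T s) (pure V W x y))"
      by (rule lin_map_comp[OF T(1) lin_map_comp[OF incl_properties(1) lin_map_eval]])
    show "lin_map (E \<otimes> F) ground (\<lambda>s. dual_incl V W E F s (pure V W (\<sigma> x) (\<psi> y)))"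
      by (rule lin_map_comp[OF incl_properties(1) lin_map_eval])
    fix d f assume "d \<in> vcar E" "f \<in> vcar F"
    then show "dual_incl V W E F (?T (pure E F d f)) (pure V W x y) =
        dual_incl V W E F (pure E F d f) (pure V W (\<sigma> x) (\<psi> y))"
      using xy lin_map_in[OF \<sigma>E, of d] lin_map_in[OF \<psi>F, of f]
      by (simp add: T(2) dual_incl_pure) (simp add: dual_map_def)
  qed
  also have "\<dots> = e (\<sigma> (\<rho> (pure V W x y)))"
    using xy e by (simp add: coaction_eval equiv)
  also have "\<dots> = dual_incl V W E F (\<gamma> (dual_map V \<sigma> e)) (pure V W x y)"
    using xy lin_map_in[OF \<sigma>E e] action_in[OF x y] by (simp add: coaction_eval) (simp add: dual_map_def)
  finally show "dual_incl V W E F (?T (\<gamma> e)) (pure V W x y) =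
      dual_incl V W E F (\<gamma> (dual_map V \<sigma> e)) (pure V W x y)" .
qed

text \<open>Under the embedding of \<open>E \<otimes> (F \<otimes> F)\<close> into the dual of
  \<open>V \<otimes> (W \<otimes> W)\<close>, the two sides evaluate at pure tensors to
  \<open>e\<close> of the two sides of the associativity hypothesis.\<close>

lemma coaction_coassoc:
  assumes "dual_coaction W W F F \<mu> \<Delta>"
    and \<kappa>: "lin_map V V \<kappa>" and \<beta>: "lin_map W W \<beta>"
    and \<kappa>E: "lin_map E E (dual_map V \<kappa>)" and \<beta>F: "lin_map F F (dual_map W \<beta>)"
    and assoc: "\<And>x y z. x \<in> vcar V \<Longrightarrow> y \<in> vcar W \<Longrightarrow> z \<in> vcar W \<Longrightarrow>
      \<rho> (pure V W (\<rho> (pure V W x y)) (\<beta> z)) = \<rho> (pure V W (\<kappa> x) (\<mu> (pure W W y z)))"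
    and e: "e \<in> vcar E"
  shows "tassoc E F F (tmap E F (E \<otimes> F) F \<gamma> (dual_map W \<beta>) (\<gamma> e)) =
    tmap E F E (F \<otimes> F) (dual_map V \<kappa>) \<Delta> (\<gamma> e)"
proof -
  let ?S = "tmap E F (E \<otimes> F) F \<gamma> (dual_map W \<beta>)" and ?T = "tmap E F E (F \<otimes> F) (dual_map V \<kappa>) \<Delta>"
  interpret W: dual_coaction W W F F \<mu> \<Delta> by fact
  note FF = vspace_tensor[of F F] and EF = vspace_tensor[of E F] and WW = vspace_tensor[of W W]
  obtain h where h: "lin_map (E \<otimes> (F \<otimes> F)) (dual (V \<otimes> (W \<otimes> W))) h"
    "inj_on h (vcar (E \<otimes> (F \<otimes> F)))"
    "\<forall>e\<in>vcar E. \<forall>t\<in>vcar (F \<otimes> F). \<forall>v\<in>vcar V. \<forall>y\<in>vcar (W \<otimes> W).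
      h (pure E (F \<otimes> F) e t) (pure V (W \<otimes> W) v y) = e v * dual_incl W W F F t y"
    by (rule dual_incl_extend[OF V WW E FF sE W.incl_properties(1) W.inj_on_dual_incl])
  note S = tmap_properties[OF E F EF F coaction_lin \<beta>F]
  note T = tmap_properties[OF E F E FF \<kappa>E W.coaction_lin]
  note A = tassoc_properties[OF E F F]
  note he = lin_map_comp[OF h(1) lin_map_eval]
  \<comment> \<open>This is stated for arbitrary \<open>t\<close> because it will be applied to
    \<gamma> \<open>d\<close>, which is a sum of pure tensors in general.\<close>
  have hA: "h (tassoc E F F (pure (E \<otimes> F) F t g)) (pure V (W \<otimes> W) x (pure W W y z)) =
      dual_incl V W E F t (pure V W x y) * g z"
    if t: "t \<in> vcar (E \<otimes> F)" and g: "g \<in> vcar F"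
      and x: "x \<in> vcar V" "y \<in> vcar W" "z \<in> vcar W" for t g x y z
  proof (rule tensor_map_unique[OF E F _ _ _ t])
    show "lin_map (E \<otimes> F) ground
        (\<lambda>t. h (tassoc E F F (pure (E \<otimes> F) F t g)) (pure V (W \<otimes> W) x (pure W W y z)))"
      by (rule lin_map_comp[OF lin_map_pure_left[OF EF F g] lin_map_comp[OF A(1) he]])
    show "lin_map (E \<otimes> F) ground (\<lambda>t. dual_incl V W E F t (pure V W x y) * g z)"
      by (rule lin_map_mult_right[OF lin_map_comp[OF incl_properties(1) lin_map_eval]])
    fix d f assume "d \<in> vcar E" "f \<in> vcar F"
    then show "h (tassoc E F F (pure (E \<otimes> F) F (pure E F d f) g)) (pure V (W \<otimes> W) x (pure W W y z)) =
        dual_incl V W E F (pure E F d f) (pure V W x y) * g z"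
      using g x by (simp add: A(2) h(3) pure_in_tensor dual_incl_pure W.dual_incl_pure)
  qed
  have in3: "tassoc E F F (?S (\<gamma> e)) \<in> vcar (E \<otimes> (F \<otimes> F))" "?T (\<gamma> e) \<in> vcar (E \<otimes> (F \<otimes> F))"
    using e by (auto intro!: lin_map_in[OF A(1)] lin_map_in[OF S(1)] lin_map_in[OF T(1)] coaction_in)
  have eval: "h (tassoc E F F (?S (\<gamma> e))) (pure V (W \<otimes> W) x (pure W W y z)) =
      h (?T (\<gamma> e)) (pure V (W \<otimes> W) x (pure W W y z))"
    if x: "x \<in> vcar V" and y: "y \<in> vcar W" and z: "z \<in> vcar W" for x y z
  proof -
    let ?p = "pure V (W \<otimes> W) x (pure W W y z)"
    note xyz = x y z action_in[OF x y] W.action_in[OF y z] lin_map_in[OF \<kappa> x] lin_map_in[OF \<beta> z]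
    have "h (tassoc E F F (?S (\<gamma> e))) ?p =
        dual_incl V W E F (\<gamma> e) (pure V W (\<rho> (pure V W x y)) (\<beta> z))"
    proof (rule tensor_map_unique[OF E F _ _ _ coaction_in[OF e]])
      show "lin_map (E \<otimes> F) ground (\<lambda>s. h (tassoc E F F (?S s)) ?p)"
        by (rule lin_map_comp[OF S(1) lin_map_comp[OF A(1) he]])
      show "lin_map (E \<otimes> F) ground
          (\<lambda>s. dual_incl V W E F s (pure V W (\<rho> (pure V W x y)) (\<beta> z)))"
        by (rule lin_map_comp[OF incl_properties(1) lin_map_eval])
      \<comment> \<open>Both sides equal the value of \<open>d\<close> at \<rho> of the pure tensor
        of \<open>x\<close> and \<open>y\<close>, times \<open>f\<close> at \<beta>
        \<open>z\<close>.\<close>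
      fix d f assume "d \<in> vcar E" "f \<in> vcar F"
      then show "h (tassoc E F F (?S (pure E F d f))) ?p =
          dual_incl V W E F (pure E F d f) (pure V W (\<rho> (pure V W x y)) (\<beta> z))"
        using xyz lin_map_in[OF \<beta>F, of f]
        by (simp add: S(2) hA coaction_in coaction_eval dual_incl_pure) (simp add: dual_map_def)
    qed
    also have "\<dots> = dual_incl V W E F (\<gamma> e) (pure V W (\<kappa> x) (\<mu> (pure W W y z)))"
      using xyz e by (simp add: coaction_eval assoc)
    also have "\<dots> = h (?T (\<gamma> e)) ?p"
    proof (rule tensor_map_unique[OF E F _ _ _ coaction_in[OF e], symmetric])
      show "lin_map (E \<otimes> F) ground (\<lambda>s. h (?T s) ?p)"
        by (rule lin_map_comp[OF T(1) he])
      show "lin_map (E \<otimes> F) ground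
          (\<lambda>s. dual_incl V W E F s (pure V W (\<kappa> x) (\<mu> (pure W W y z))))"
        by (rule lin_map_comp[OF incl_properties(1) lin_map_eval])
      fix d f assume "d \<in> vcar E" "f \<in> vcar F"
      then show "h (?T (pure E F d f)) ?p =
          dual_incl V W E F (pure E F d f) (pure V W (\<kappa> x) (\<mu> (pure W W y z)))"
        using xyz lin_map_in[OF \<kappa>E, of d]
        by (simp add: T(2) h(3) pure_in_tensor W.coaction_in W.coaction_eval dual_incl_pure)
          (simp add: dual_map_def)
    qed
    finally show ?thesis .
  qed
  show ?thesis
  proof (rule inj_onD[OF h(2) _ in3], rule ext)
    fix p
    let ?l = "h (tassoc E F F (?S (\<gamma> e)))" and ?r = "h (?T (\<gamma> e))"
    have lr: "?l \<in> vcar (dual (V \<otimes> (W \<otimes> W)))" "?r \<in> vcar (dual (V \<otimes> (W \<otimes> W)))"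
      using in3 lin_map_in[OF h(1)] by blast+
    then have l: "lin_map (V \<otimes> (W \<otimes> W)) ground ?l" "lin_map (V \<otimes> (W \<otimes> W)) ground ?r"
      by (simp_all add: dual_def)
    show "?l p = ?r p"
    \<comment> \<open>On the carrier, linearity reduces first the outer and then the inner tensor
      factor to pure tensors; off it, both functionals are 0 by normalisation.\<close>
    proof (cases "p \<in> vcar (V \<otimes> (W \<otimes> W))")
      case True
      show ?thesis
      proof (rule tensor_map_unique[OF V WW l _ True])
        fix x t assume x: "x \<in> vcar V" and t: "t \<in> vcar (W \<otimes> W)"
        note P = lin_map_pure_right[OF V WW x]
        show "?l (pure V (W \<otimes> W) x t) = ?r (pure V (W \<otimes> W) x t)"
          by (rule tensor_map_unique[OF W W lin_map_comp[OF P l(1)] lin_map_comp[OF P l(2)] _ t])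
            (rule eval[OF x])
      qed
    qed (use lr in \<open>simp add: dual_def\<close>)
  qed
qed

end

text \<open>Inverting the inclusion is legitimate once the transposes lie in its image. This links
  the explicit Sweedler maps to the abstract setting.\<close>

lemma (in dual_pair) dual_coaction_the_inv_into:
  assumes \<rho>: "lin_map (V \<otimes> W) V \<rho>"
    and im: "\<And>e. e \<in> vcar E \<Longrightarrow> dual_map (V \<otimes> W) \<rho> e \<in> dual_incl V W E F ` vcar (E \<otimes> F)"
  shows "dual_coaction V W E F \<rho>
    (\<lambda>e. the_inv_into (vcar (E \<otimes> F)) (dual_incl V W E F) (dual_map (V \<otimes> W) \<rho> e))"
proof unfold_locales
  fix e assume e: "e \<in> vcar E"
  show "the_inv_into (vcar (E \<otimes> F)) (dual_incl V W E F) (dual_map (V \<otimes> W) \<rho> e) \<in> vcar (E \<otimes> F)"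
    by (rule the_inv_into_into[OF inj_on_dual_incl im[OF e] order_refl])
  fix x y assume "x \<in> vcar V" "y \<in> vcar W"
  then show "dual_incl V W E F
      (the_inv_into (vcar (E \<otimes> F)) (dual_incl V W E F) (dual_map (V \<otimes> W) \<rho> e)) (pure V W x y) =
      e (\<rho> (pure V W x y))"
    unfolding f_the_inv_into_f[OF inj_on_dual_incl im[OF e]]
    by (simp add: dual_map_def pure_in_tensor)
qed (rule \<rho>)


section \<open>Sweedler duals\<close>

context bihom_algebra
begin

abbreviation "cofinite_ideal J \<equiv> bihom_ideal G \<mu> \<alpha> \<beta> J \<and> finite_codim G J"
abbreviation "Gdeg \<equiv> sweedler_algebra G \<mu> \<alpha> \<beta>"

text \<open>Supplies a witnessing ideal for the zero functional.\<close>

lemma cofinite_ideal_UNIV: "cofinite_ideal (vcar G)"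
proof -
  interpret vector_space "vscale G" using G_vspace by (simp add: vspace_def)
  have "finite_codim G (vcar G)"
    unfolding finite_codim_def by (rule exI[of _ "{}"]) simp
  then show ?thesis
    using G_vspace lin_map_in[OF alpha_lin] lin_map_in[OF beta_lin] lin_map_in[OF mu_lin]
    by (auto simp: bihom_ideal_def vspace_def pure_in_tensor)
qed

text \<open>A sum of two functionals in a Sweedler dual is witnessed by the intersection of their
  ideals.\<close>

lemma cofinite_ideal_Int:
  assumes "cofinite_ideal H" "cofinite_ideal J"
  shows "cofinite_ideal (H \<inter> J)"
proof -
  interpret vector_space "vscale G" using G_vspace by (simp add: vspace_def)
  have "finite_codim G (H \<inter> J)"
    using assms by (intro finite_codim_Int[OF G_vspace]) (auto simp: bihom_ideal_def)
  moreover have "bihom_ideal G \<mu> \<alpha> \<beta> (H \<inter> J)"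
    using assms subspace_inter by (auto simp: bihom_ideal_def)
  ultimately show ?thesis by blast
qed

text \<open>Both Sweedler duals have the shape considered here, with \<open>Z J = J\<close> and
  \<open>Z J = M \<cdot> J\<close>.\<close>

lemma vspace_sweedler:
  assumes V: "vspace V" and Z: "\<And>H J. H \<subseteq> J \<Longrightarrow> Z H \<subseteq> Z J"
  shows "vspace ((dual V)\<lparr>vcar := {f \<in> vcar (dual V). \<exists>J. cofinite_ideal J \<and> (\<forall>x\<in>Z J. f x = 0)}\<rparr>)"
proof -
  note cl = vspace_closed[OF vspace_dual[OF V]]
  have s: "vscale (dual V) = pointwise" by (simp add: dual_def)
  let ?S = "{f \<in> vcar (dual V). \<exists>J. cofinite_ideal J \<and> (\<forall>x\<in>Z J. f x = 0)}"
  have "pw.subspace ?S"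
  proof (rule pw.subspaceI)
    show "0 \<in> ?S" using cofinite_ideal_UNIV cl(1) by auto
  next
    fix f g assume "f \<in> ?S" "g \<in> ?S"
    then obtain H J where f: "f \<in> vcar (dual V)" "cofinite_ideal H" "\<forall>x\<in>Z H. f x = 0"
      and g: "g \<in> vcar (dual V)" "cofinite_ideal J" "\<forall>x\<in>Z J. g x = 0" by blast
    have "\<forall>x\<in>Z (H \<inter> J). (f + g) x = 0"
    proof
      fix x assume "x \<in> Z (H \<inter> J)"
      then have "x \<in> Z H" "x \<in> Z J" using Z[of "H \<inter> J" H] Z[of "H \<inter> J" J] by blast+
      then show "(f + g) x = 0" using f(3) g(3) by simp
    qed
    then show "f + g \<in> ?S" using cl(2)[OF f(1) g(1)] cofinite_ideal_Int[OF f(2) g(2)] by blast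
  next
    fix c f assume "f \<in> ?S"
    then show "pointwise c f \<in> ?S"
      using cl(3)[of f c] by (auto simp: s) (auto simp: pointwise_def)
  qed
  then show ?thesis by (simp add: vspace_def s vector_space_pointwise)
qed

lemma sweedler_algebra_iff:
  "f \<in> vcar Gdeg \<longleftrightarrow> f \<in> vcar (dual G) \<and> (\<exists>J. cofinite_ideal J \<and> (\<forall>x\<in>J. f x = 0))"
  by (auto simp: sweedler_algebra_def)

lemma sweedler_algebra_scale: "vscale Gdeg = pointwise"
  by (simp add: sweedler_algebra_def dual_def)

lemma vspace_sweedler_algebra: "vspace Gdeg"
  using vspace_sweedler[OF G_vspace, of "\<lambda>J. J"] by (simp add: sweedler_algebra_def)

lemma dual_pair_algebra: "dual_pair G G Gdeg Gdeg"
  by unfold_locales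
    (auto simp: G_vspace vspace_sweedler_algebra sweedler_algebra_scale sweedler_algebra_iff)

text \<open>The ideal \<open>J\<close> that witnesses \<open>f\<close> also witnesses
  \<open>f\<close> composed with \<open>h\<close>, since \<open>h\<close> maps \<open>J\<close> into
  itself.\<close>

lemma dual_map_sweedler_algebra:
  assumes "lin_map G G h" "\<And>J. bihom_ideal G \<mu> \<alpha> \<beta> J \<Longrightarrow> h ` J \<subseteq> J"
  shows "lin_map Gdeg Gdeg (dual_map G h)"
proof (rule lin_map_dual_map[OF sweedler_algebra_scale])
  fix f assume "f \<in> vcar Gdeg"
  then obtain J where f: "f \<in> vcar (dual G)" "cofinite_ideal J" "\<forall>x\<in>J. f x = 0"
    unfolding sweedler_algebra_iff by blast
  then have "\<forall>x\<in>J. dual_map G h f x = 0" using assms(2)[of J] by (auto simp: dual_map_def)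
  then show "dual_map G h f \<in> vcar Gdeg"
    unfolding sweedler_algebra_iff using dual_map_in_dual[OF G_vspace assms(1) f(1)] f(2) by blast
qed

lemma dual_alpha_lin: "lin_map Gdeg Gdeg (dual_map G \<alpha>)"
  by (rule dual_map_sweedler_algebra[OF alpha_lin]) (unfold bihom_ideal_def, blast)

lemma dual_beta_lin: "lin_map Gdeg Gdeg (dual_map G \<beta>)"
  by (rule dual_map_sweedler_algebra[OF beta_lin]) (unfold bihom_ideal_def, blast)

text \<open>Both sides of the ideal enter: left multiples stay in \<open>J\<close>, so the form
  kills \<open>G \<otimes> J\<close>; right multiples stay in \<open>J\<close>, so each slice in the
  first argument again kills \<open>J\<close>.\<close>

lemma dual_mult_image:
  assumes "f \<in> vcar Gdeg"
  shows "dual_map (G \<otimes> G) \<mu> f \<in> dual_incl G G Gdeg Gdeg ` vcar (Gdeg \<otimes> Gdeg)"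
proof -
  obtain J where f: "f \<in> vcar (dual G)" and J: "cofinite_ideal J" "\<forall>x\<in>J. f x = 0"
    using assms unfolding sweedler_algebra_iff by blast
  have id: "J \<subseteq> vcar G" "module.subspace (vscale G) J" "finite_codim G J"
    "\<And>a b. a \<in> vcar G \<Longrightarrow> b \<in> J \<Longrightarrow> \<mu> (pure G G a b) \<in> J"
    "\<And>a b. a \<in> vcar G \<Longrightarrow> b \<in> J \<Longrightarrow> \<mu> (pure G G b a) \<in> J"
    using J(1) by (auto simp: bihom_ideal_def)
  have p: "dual_map (G \<otimes> G) \<mu> f \<in> vcar (dual (G \<otimes> G))"
    by (rule dual_map_in_dual[OF vspace_tensor mu_lin f])
  show ?thesis
  proof (rule dual_pair.dual_incl_image[OF dual_pair_algebra p id(1-3)])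
    show "dual_map (G \<otimes> G) \<mu> f (pure G G x j) = 0" if "x \<in> vcar G" "j \<in> J" for x j
      using that J(2) id(4) by (simp add: dual_map_def)
    show "dual_map G (\<lambda>x. pure G G x y) (dual_map (G \<otimes> G) \<mu> f) \<in> vcar Gdeg" (is "?f \<in> _")
      if y: "y \<in> vcar G" for y
    proof -
      have "?f \<in> vcar (dual G)"
        by (rule dual_map_in_dual[OF G_vspace lin_map_pure_left[OF G_vspace G_vspace y] p])
      moreover have "\<forall>x\<in>J. ?f x = 0" using y J(2) id(5) by (simp add: dual_map_def)
      ultimately show ?thesis using J(1) unfolding sweedler_algebra_iff by blast
    qed
    show "g \<in> vcar Gdeg" if "g \<in> vcar (dual G)" "\<And>j. j \<in> J \<Longrightarrow> g j = 0" for g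
      using that J(1) unfolding sweedler_algebra_iff by blast
  qed
qed

lemma dual_coaction_comult: "dual_coaction G G Gdeg Gdeg \<mu> (sweedler_comult G \<mu> \<alpha> \<beta>)"
  using dual_pair.dual_coaction_the_inv_into[OF dual_pair_algebra mu_lin dual_mult_image]
  by (simp add: sweedler_comult_def[abs_def] Let_def)

text \<open>\<open>G\<close> acts on itself with \<alpha> in the role of \<kappa>; multiplicativity
  of \<alpha> and \<beta> is equivariance of this action.\<close>

lemma bihom_coalgebra_sweedler:
  "bihom_coalgebra Gdeg (sweedler_comult G \<mu> \<alpha> \<beta>) (dual_map G \<beta>) (dual_map G \<alpha>)"
proof -
  interpret dual_coaction G G Gdeg Gdeg \<mu> "sweedler_comult G \<mu> \<alpha> \<beta>"
    by (rule dual_coaction_comult)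
  show ?thesis
  proof
    show "vspace Gdeg" by (rule vspace_sweedler_algebra)
    show "lin_map Gdeg (Gdeg \<otimes> Gdeg) (sweedler_comult G \<mu> \<alpha> \<beta>)" by (rule coaction_lin)
    show "lin_map Gdeg Gdeg (dual_map G \<beta>)" by (rule dual_beta_lin)
    show "lin_map Gdeg Gdeg (dual_map G \<alpha>)" by (rule dual_alpha_lin)
    fix c assume c: "c \<in> vcar Gdeg"
    show "dual_map G \<beta> (dual_map G \<alpha> c) = dual_map G \<alpha> (dual_map G \<beta> c)"
      using lin_map_in[OF alpha_lin] lin_map_in[OF beta_lin] alpha_beta
      by (simp add: dual_map_def fun_eq_iff)
    show "tmap Gdeg Gdeg Gdeg (Gdeg \<otimes> Gdeg) (dual_map G \<alpha>) (sweedler_comult G \<mu> \<alpha> \<beta>)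
        (sweedler_comult G \<mu> \<alpha> \<beta> c) =
      tassoc Gdeg Gdeg Gdeg (tmap Gdeg Gdeg (Gdeg \<otimes> Gdeg) Gdeg (sweedler_comult G \<mu> \<alpha> \<beta>)
        (dual_map G \<beta>) (sweedler_comult G \<mu> \<alpha> \<beta> c))"
      by (rule coaction_coassoc[OF dual_coaction_comult alpha_lin beta_lin dual_alpha_lin
            dual_beta_lin bihom_assoc[symmetric] c, symmetric])
    show "sweedler_comult G \<mu> \<alpha> \<beta> (dual_map G \<beta> c) =
        tmap Gdeg Gdeg Gdeg Gdeg (dual_map G \<beta>) (dual_map G \<beta>) (sweedler_comult G \<mu> \<alpha> \<beta> c)"
      by (rule coaction_equivariant[OF beta_lin beta_lin dual_beta_lin dual_beta_lin
            beta_mult[symmetric] c, symmetric])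
    show "sweedler_comult G \<mu> \<alpha> \<beta> (dual_map G \<alpha> c) =
        tmap Gdeg Gdeg Gdeg Gdeg (dual_map G \<alpha>) (dual_map G \<alpha>) (sweedler_comult G \<mu> \<alpha> \<beta> c)"
      by (rule coaction_equivariant[OF alpha_lin alpha_lin dual_alpha_lin dual_alpha_lin
            alpha_mult[symmetric] c, symmetric])
  qed
qed

end

section \<open>The Sweedler dual comodule of a right BiHom-module\<close>

context bihom_right_module
begin

abbreviation "Mdeg \<equiv> sweedler_module G \<mu> \<alpha> \<beta> M \<rho>"
abbreviation act (infixl "\<cdot>" 75) where "m \<cdot> g \<equiv> \<rho> (pure M G m g)"

lemma act_in: "m \<in> vcar M \<Longrightarrow> g \<in> vcar G \<Longrightarrow> m \<cdot> g \<in> vcar M"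
  by (intro lin_map_in[OF rho_lin] pure_in_tensor)

lemma act_assoc:
  assumes "m \<in> vcar M" "g \<in> vcar G" "h \<in> vcar G"
  shows "(m \<cdot> g) \<cdot> \<beta> h = \<kappa> m \<cdot> \<mu> (pure G G g h)"
  using module_assoc[of "pure (M \<otimes> G) G (pure M G m g) h"] assms
  by (simp add: pure_in_tensor tassoc_properties[OF M_vspace G_vspace G_vspace]
      tmap_properties[OF vspace_tensor G_vspace M_vspace G_vspace rho_lin beta_lin]
      tmap_properties[OF M_vspace vspace_tensor M_vspace G_vspace kappa_lin mu_lin])

lemma kappa_act: "m \<in> vcar M \<Longrightarrow> g \<in> vcar G \<Longrightarrow> \<kappa> m \<cdot> \<alpha> g = \<kappa> (m \<cdot> g)"
  using kappa_rho[of "pure M G m g"]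
  by (simp add: pure_in_tensor
      tmap_properties[OF M_vspace G_vspace M_vspace G_vspace kappa_lin alpha_lin])

lemma tau_act: "m \<in> vcar M \<Longrightarrow> g \<in> vcar G \<Longrightarrow> \<tau> m \<cdot> \<beta> g = \<tau> (m \<cdot> g)"
  using tau_rho[of "pure M G m g"]
  by (simp add: pure_in_tensor
      tmap_properties[OF M_vspace G_vspace M_vspace G_vspace tau_lin beta_lin])

text \<open>A linear functional vanishes on the span \<open>M\<cdot>J\<close> as soon as it vanishes
  on the generators, because its kernel is a subspace.\<close>

lemma sweedler_module_iff:
  "f \<in> vcar Mdeg \<longleftrightarrow> f \<in> vcar (dual M) \<and>
    (\<exists>J. cofinite_ideal J \<and> (\<forall>m\<in>vcar M. \<forall>j\<in>J. f (m \<cdot> j) = 0))"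
proof -
  interpret vector_space "vscale M" using M_vspace by (simp add: vspace_def)
  have sM: "subspace (vcar M)" using M_vspace by (simp add: vspace_def)
  have "(\<forall>x\<in>module_times_ideal G M \<rho> J. f x = 0) \<longleftrightarrow> (\<forall>m\<in>vcar M. \<forall>j\<in>J. f (m \<cdot> j) = 0)"
    if f: "f \<in> vcar (dual M)" and J: "cofinite_ideal J" for J
  proof
    let ?S = "{m \<cdot> j | m j. m \<in> vcar M \<and> j \<in> J}"
    show "\<forall>m\<in>vcar M. \<forall>j\<in>J. f (m \<cdot> j) = 0" if "\<forall>x\<in>module_times_ideal G M \<rho> J. f x = 0"
      using that span_base[of _ ?S] unfolding module_times_ideal_def by blast
    assume *: "\<forall>m\<in>vcar M. \<forall>j\<in>J. f (m \<cdot> j) = 0"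
    have "subspace {x \<in> vcar M. f x = 0}"
      using f vspace_closed[OF M_vspace] lin_map_zero[OF M_vspace, of ground f]
      by (auto simp: subspace_def dual_def lin_map_def ground_def)
    moreover have "?S \<subseteq> {x \<in> vcar M. f x = 0}"
      using * J by (auto simp: bihom_ideal_def intro!: act_in)
    ultimately have "span ?S \<subseteq> {x \<in> vcar M. f x = 0}" by (intro span_minimal)
    then show "\<forall>x\<in>module_times_ideal G M \<rho> J. f x = 0" unfolding module_times_ideal_def by blast
  qed
  then show ?thesis by (simp add: sweedler_module_def) blast
qed

lemma sweedler_module_scale: "vscale Mdeg = pointwise"
  by (simp add: sweedler_module_def dual_def)

lemma vspace_sweedler_module: "vspace Mdeg"
proof -
  interpret vector_space "vscale M" using M_vspace by (simp add: vspace_def)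
  have "module_times_ideal G M \<rho> H \<subseteq> module_times_ideal G M \<rho> J" if "H \<subseteq> J" for H J
    using that unfolding module_times_ideal_def by (intro span_mono) blast
  from vspace_sweedler[OF M_vspace this] show ?thesis
    by (simp add: sweedler_module_def)
qed

lemma dual_pair_module: "dual_pair M G Mdeg Gdeg"
  by unfold_locales
    (auto simp: G_vspace M_vspace vspace_sweedler_algebra vspace_sweedler_module
      sweedler_algebra_scale sweedler_module_scale sweedler_algebra_iff sweedler_module_iff)

text \<open>The witnessing ideal is kept: \<open>h (m\<cdot>j)\<close> is the product of
  \<open>h m\<close> and \<open>k j\<close>, and \<open>k j\<close> is still in \<open>J\<close>.
  The cases are \<kappa> with \<alpha> and \<tau> with \<beta>.\<close>

lemma dual_map_sweedler_module:
  assumes h: "lin_map M M h" and k: "\<And>J. bihom_ideal G \<mu> \<alpha> \<beta> J \<Longrightarrow> k ` J \<subseteq> J"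
    and hk: "\<And>m g. m \<in> vcar M \<Longrightarrow> g \<in> vcar G \<Longrightarrow> h m \<cdot> k g = h (m \<cdot> g)"
  shows "lin_map Mdeg Mdeg (dual_map M h)"
proof (rule lin_map_dual_map[OF sweedler_module_scale])
  fix f assume "f \<in> vcar Mdeg"
  then obtain J where f: "f \<in> vcar (dual M)" and J: "cofinite_ideal J"
    and 0: "\<forall>m\<in>vcar M. \<forall>j\<in>J. f (m \<cdot> j) = 0"
    unfolding sweedler_module_iff by blast
  have "dual_map M h f (m \<cdot> j) = 0" if m: "m \<in> vcar M" and j: "j \<in> J" for m j
  proof -
    have jG: "j \<in> vcar G" using J j by (auto simp: bihom_ideal_def)
    have "f (h m \<cdot> k j) = 0" using 0 lin_map_in[OF h m] k[of J] J j by blast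
    then show ?thesis using m jG by (simp add: dual_map_def hk)
  qed
  then show "dual_map M h f \<in> vcar Mdeg"
    unfolding sweedler_module_iff using dual_map_in_dual[OF M_vspace h f] J by blast
qed

lemma dual_kappa_lin: "lin_map Mdeg Mdeg (dual_map M \<kappa>)"
  by (rule dual_map_sweedler_module[OF kappa_lin _ kappa_act]) (unfold bihom_ideal_def, blast)+

lemma dual_tau_lin: "lin_map Mdeg Mdeg (dual_map M \<tau>)"
  by (rule dual_map_sweedler_module[OF tau_lin _ tau_act]) (unfold bihom_ideal_def, blast)+

lemma dual_action_image:
  assumes surj: "\<beta> ` vcar G = vcar G" and "\<xi> \<in> vcar Mdeg"
  shows "dual_map (M \<otimes> G) \<rho> \<xi> \<in> dual_incl M G Mdeg Gdeg ` vcar (Mdeg \<otimes> Gdeg)"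
proof -
  obtain J where \<xi>: "\<xi> \<in> vcar (dual M)" and J: "cofinite_ideal J"
    and 0: "\<And>m j. m \<in> vcar M \<Longrightarrow> j \<in> J \<Longrightarrow> \<xi> (m \<cdot> j) = 0"
    using assms(2) unfolding sweedler_module_iff by blast
  have id: "J \<subseteq> vcar G" "module.subspace (vscale G) J" "finite_codim G J"
    "\<And>a b. a \<in> vcar G \<Longrightarrow> b \<in> J \<Longrightarrow> \<mu> (pure G G b a) \<in> J"
    using J(1) by (auto simp: bihom_ideal_def)
  have p: "dual_map (M \<otimes> G) \<rho> \<xi> \<in> vcar (dual (M \<otimes> G))"
    by (rule dual_map_in_dual[OF vspace_tensor rho_lin \<xi>])
  show ?thesis
  proof (rule dual_pair.dual_incl_image[OF dual_pair_module p id(1-3)])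
    show "dual_map (M \<otimes> G) \<rho> \<xi> (pure M G x j) = 0" if "x \<in> vcar M" "j \<in> J" for x j
      using that 0 by (simp add: dual_map_def)
    show "dual_map M (\<lambda>x. pure M G x y) (dual_map (M \<otimes> G) \<rho> \<xi>) \<in> vcar Mdeg" (is "?f \<in> _")
      if y: "y \<in> vcar G" for y
    proof -
      \<comment> \<open>Only elements of the form \<beta> \<open>z\<close> can be absorbed by the
        twisted associativity law, hence the appeal to surjectivity.\<close>
      obtain z where z: "z \<in> vcar G" "y = \<beta> z" using y surj by blast
      have "?f (m \<cdot> j) = 0" if m: "m \<in> vcar M" and j: "j \<in> J" for m j
      proof -
        have jG: "j \<in> vcar G" using id(1) j by blast
        have "?f (m \<cdot> j) = \<xi> ((m \<cdot> j) \<cdot> \<beta> z)"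
          using act_in[OF m jG] y z by (simp add: dual_map_def pure_in_tensor)
        also have "\<dots> = \<xi> (\<kappa> m \<cdot> \<mu> (pure G G j z))" by (simp only: act_assoc[OF m jG z(1)])
        \<comment> \<open>The product of \<open>j\<close> and \<open>z\<close> lies in the ideal
          \<open>J\<close>, so the argument of \<xi> is a generator of
          \<open>M\<cdot>J\<close>.\<close>
        also have "\<dots> = 0" by (intro 0 id(4) lin_map_in[OF kappa_lin] m j z(1))
        finally show ?thesis .
      qed
      moreover have "?f \<in> vcar (dual M)"
        by (rule dual_map_in_dual[OF M_vspace lin_map_pure_left[OF M_vspace G_vspace y] p])
      ultimately show ?thesis using J unfolding sweedler_module_iff by blast
    qed
    show "g \<in> vcar Gdeg" if "g \<in> vcar (dual G)" "\<And>j. j \<in> J \<Longrightarrow> g j = 0" for g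
      using that J unfolding sweedler_algebra_iff by blast
  qed
qed

text \<open>The module axioms pair \<tau> with \<beta> and \<kappa> with \<alpha>; since \<psi> and
  \<phi> are the transposes of \<beta> and \<alpha>, the transpose of \<tau> comes first.\<close>

lemma bihom_right_comodule_sweedler:
  assumes surj: "\<beta> ` vcar G = vcar G"
  shows "bihom_right_comodule
    Gdeg (sweedler_comult G \<mu> \<alpha> \<beta>) (dual_map G \<beta>) (dual_map G \<alpha>)
    Mdeg (sweedler_coaction G \<mu> \<alpha> \<beta> M \<rho>) (dual_map M \<tau>) (dual_map M \<kappa>)"
proof -
  let ?\<gamma> = "sweedler_coaction G \<mu> \<alpha> \<beta> M \<rho>" and ?\<Delta> = "sweedler_comult G \<mu> \<alpha> \<beta>"
  interpret C: bihom_coalgebra Gdeg ?\<Delta> "dual_map G \<beta>" "dual_map G \<alpha>"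
    by (rule bihom_coalgebra_sweedler)
  interpret dual_coaction M G Mdeg Gdeg \<rho> ?\<gamma>
    using dual_pair.dual_coaction_the_inv_into[OF dual_pair_module rho_lin dual_action_image[OF surj]]
    by (simp add: sweedler_coaction_def[abs_def] Let_def)
  show ?thesis
  proof
    show "vspace Mdeg" by (rule vspace_sweedler_module)
    show "lin_map Mdeg (Mdeg \<otimes> Gdeg) ?\<gamma>" by (rule coaction_lin)
    show "lin_map Mdeg Mdeg (dual_map M \<tau>)" by (rule dual_tau_lin)
    show "lin_map Mdeg Mdeg (dual_map M \<kappa>)" by (rule dual_kappa_lin)
    fix a assume a: "a \<in> vcar Mdeg"
    show "dual_map M \<tau> (dual_map M \<kappa> a) = dual_map M \<kappa> (dual_map M \<tau> a)"
      using lin_map_in[OF kappa_lin] lin_map_in[OF tau_lin] kappa_tau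
      by (simp add: dual_map_def fun_eq_iff)
    show "tassoc Mdeg Gdeg Gdeg (tmap Mdeg Gdeg (Mdeg \<otimes> Gdeg) Gdeg ?\<gamma> (dual_map G \<beta>) (?\<gamma> a)) =
        tmap Mdeg Gdeg Mdeg (Gdeg \<otimes> Gdeg) (dual_map M \<kappa>) ?\<Delta> (?\<gamma> a)"
      by (rule coaction_coassoc[OF dual_coaction_comult kappa_lin beta_lin dual_kappa_lin
            dual_beta_lin act_assoc a])
    show "tmap Mdeg Gdeg Mdeg Gdeg (dual_map M \<tau>) (dual_map G \<beta>) (?\<gamma> a) = ?\<gamma> (dual_map M \<tau> a)"
      by (rule coaction_equivariant[OF tau_lin beta_lin dual_tau_lin dual_beta_lin tau_act a])
    show "tmap Mdeg Gdeg Mdeg Gdeg (dual_map M \<kappa>) (dual_map G \<alpha>) (?\<gamma> a) = ?\<gamma> (dual_map M \<kappa> a)"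
      by (rule coaction_equivariant[OF kappa_lin alpha_lin dual_kappa_lin dual_alpha_lin kappa_act a])
  qed
qed

end

text \<open>The first conjunct gives the coaction its meaning: \<open>sweedler_coaction\<close>
  inverts the inclusion by \<open>the_inv_into\<close>, which is informative only on the
  image.\<close>

theorem theorem4:
  fixes G :: "('k::field_char_0, 'g::ab_group_add) vsp"
    and \<mu> :: "('k, 'g, 'g) tensor \<Rightarrow> 'g"
    and \<alpha> \<beta> :: "'g \<Rightarrow> 'g"
    and M :: "('k, 'm::ab_group_add) vsp"
    and \<rho> :: "('k, 'm, 'g) tensor \<Rightarrow> 'm"
    and \<kappa> \<tau> :: "'m \<Rightarrow> 'm"
  assumes algebra: "bihom_algebra G \<mu> \<alpha> \<beta>"
    and beta_surj: "\<beta> ` vcar G = vcar G"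
    and module: "bihom_right_module G \<mu> \<alpha> \<beta> M \<rho> \<kappa> \<tau>"
  shows "let Gdeg = sweedler_algebra G \<mu> \<alpha> \<beta>; Mdeg = sweedler_module G \<mu> \<alpha> \<beta> M \<rho> in
         (\<forall>\<xi>\<in>vcar Mdeg.
            dual_map (M \<otimes> G) \<rho> \<xi> \<in> dual_incl M G Mdeg Gdeg ` vcar (Mdeg \<otimes> Gdeg)) \<and>
         bihom_right_comodule
           Gdeg (sweedler_comult G \<mu> \<alpha> \<beta>) (dual_map G \<beta>) (dual_map G \<alpha>)
           Mdeg (sweedler_coaction G \<mu> \<alpha> \<beta> M \<rho>) (dual_map M \<tau>) (dual_map M \<kappa>)"
proof -
  interpret bihom_right_module G \<mu> \<alpha> \<beta> M \<rho> \<kappa> \<tau> by (rule module)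
  show ?thesis
    unfolding Let_def
    using dual_action_image[OF beta_surj] bihom_right_comodule_sweedler[OF beta_surj] by blast
qed

end
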